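(* Let $q\ge0$, $f\in L^2((0,T);\dot H^1)$ and $u_0\in H$. Then there exists a unique $\hat U=(\hat U_1,\hat U_2)\in\mathcal{Y}_{k,q}\times H$ such that $\mathscr{B}^*(\hat U,X)=\mathscr{F}(X)$ for all $X\in\mathcal{X}_{k,q+1}$. Moreover, \[ |\hat U|_{\mathcal{Y}_H}\le\Big(\|f\|_{L^2((0,T);\dot H^{-1})}^2+k^2\|f\|_{L^2((0,T);\dot H^1)}^2+\|u_0\|_H^2\Big)^{\frac12} . \]
   Context: Let $V\hookrightarrow H\hookrightarrow V^*$ be a Gelfand triple of real separable Hilbert spaces, with $V$ densely embedded in $H$. Write $(\cdot,\cdot)$ for the inner product of $H$ and $\langle\cdot,\cdot\rangle$ for the duality. Let $A:V\to V^*$ be the operator associated with a symmetric, bounded, coercive bilinear form on $V$. For $\gamma\in\mathbb{R}$, $\dot H^\gamma=D(A^{\gamma/2})$ with norm $\|A^{\gamma/2}\cdot\|_H$, so $\dot H^1=V$ and $\dot H^{-1}=V^*$. Let $0=t_0<\dots<t_N=T$, $I_i=[t_i,t_{i+1}]$ and $k=\max_i(t_{i+1}-t_i)$. Define: - $\mathcal{Y}_{k,q}$: the set of $Y\in L^2((0,T);V)$ that are polynomials in $t$ of degree $\le q$ with coefficients in $\dot H^1$ on each $I_i$; - $\mathcal{X}_{k,q+1}$: the set of $X\in L^2((0,T);V)\cap H^1((0,T);V^* )$ that are polynomials in $t$ of degree $\le q+1$ with coefficients in $\dot H^1$ on each $I_i$; - $\mathscr{B}^*(Y,X)=\int_0^T\langle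 Y_1,-\dot X+AX\rangle\,\mathrm{d}s+(Y_2,X(T))$; - $\mathscr{F}(X)=\int_0^T\langle f,X\rangle\,\mathrm{d}s+(u_0,X(0))$; - $|Y|_{\mathcal{Y}_H}^2=\|Y_2\|_H^2+\int_0^T\|A^{1/2}Y_1\|_H^2\,\mathrm{d}s$. *)

theory Defs
  imports "HOL-Analysis.Analysis"
begin

definition mesh_ok :: "(nat \<Rightarrow> real) \<Rightarrow> nat \<Rightarrow> real \<Rightarrow> bool" where
  "mesh_ok tt N T \<longleftrightarrow> 0 < N \<and> tt 0 = 0 \<and> tt N = T \<and> (\<forall>i<N. tt i < tt (Suc i))"

definition max_step :: "(nat \<Rightarrow> real) \<Rightarrow> nat \<Rightarrow> real" where
  "max_step tt N = Max ((\<lambda>i. tt (Suc i) - tt i) ` {..<N})"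

text \<open>Y_{k,q}: (L^2 classes of) functions that are polynomials of degree at most q in t with
  coefficients in V on each (open) interval; values at the nodes are irrelevant.\<close>
definition Y_space :: "(nat \<Rightarrow> real) \<Rightarrow> nat \<Rightarrow> nat \<Rightarrow> (real \<Rightarrow> 'v::real_vector) \<Rightarrow> bool" where
  "Y_space tt N q Y \<longleftrightarrow>
     (\<forall>i<N. \<exists>c::nat \<Rightarrow> 'v. \<forall>s\<in>{tt i<..<tt (Suc i)}. Y s = (\<Sum>j\<le>q. (s ^ j) *\<^sub>R c j))"

text \<open>X_{k,q+1}: functions that are polynomials of degree at most q+1 with coefficients in V on
  each closed interval I_i (so continuous at the nodes, i.e. in H^1((0,T);V^*)).\<close>
definition X_space :: "(nat \<Rightarrow> real) \<Rightarrow> nat \<Rightarrow> nat \<Rightarrow> (real \<Rightarrow> 'v::real_vector) \<Rightarrow> bool" where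
  "X_space tt N q X \<longleftrightarrow>
     (\<forall>i<N. \<exists>c::nat \<Rightarrow> 'v. \<forall>s\<in>{tt i..tt (Suc i)}. X s = (\<Sum>j\<le>Suc q. (s ^ j) *\<^sub>R c j))"

text \<open>B^*(Y,X) = int_0^T <Y_1, -X' + A X> ds + (Y_2, X(T)).  Here iota : V -> H is the embedding,
  <Y_1, X'> = (Y_1, X')_H since X' takes values in V, and <A X, Y_1> = a(X, Y_1).\<close>
definition Bstar :: "('v::real_normed_vector \<Rightarrow> 'h::real_inner) \<Rightarrow> ('v \<Rightarrow> 'v \<Rightarrow> real) \<Rightarrow> real
    \<Rightarrow> (real \<Rightarrow> 'v) \<Rightarrow> 'h \<Rightarrow> (real \<Rightarrow> 'v) \<Rightarrow> real" where
  "Bstar \<iota> a T Y1 Y2 X =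
     integral {0..T} (\<lambda>s. - (\<iota> (Y1 s) \<bullet> \<iota> (vector_derivative X (at s))) + a (X s) (Y1 s))
     + Y2 \<bullet> \<iota> (X T)"

definition Fform :: "('v \<Rightarrow> 'h::real_inner) \<Rightarrow> real \<Rightarrow> (real \<Rightarrow> 'v) \<Rightarrow> 'h \<Rightarrow> (real \<Rightarrow> 'v) \<Rightarrow> real" where
  "Fform \<iota> T f u0 X = integral {0..T} (\<lambda>s. \<iota> (f s) \<bullet> \<iota> (X s)) + u0 \<bullet> \<iota> (X 0)"

text \<open>Norm of dot H^{-1} = V^*, dual to the dot H^1 norm ||A^{1/2} w||_H = sqrt (a w w):
  sup over w in V of (h, w)_H / ||A^{1/2} w||_H  (w = 0 contributes 0/0 = 0).\<close>
definition dual_norm :: "('v \<Rightarrow> 'h::real_inner) \<Rightarrow> ('v \<Rightarrow> 'v \<Rightarrow> real) \<Rightarrow> 'h \<Rightarrow> real" where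
  "dual_norm \<iota> a h = (SUP w. (h \<bullet> \<iota> w) / sqrt (a w w))"

end

theory Submission
  imports Defs
begin

text \<open>
  On each interval expand everything in an orthonormal basis of the polynomials of degree at most
  \<open>q\<close>. Then \<open>B\<^sup>*(Y, X) = \<langle>Y, S X\<rangle>\<close> for the Hilbert inner product of \<open>|\<cdot>|\<^sub>Y\<^sub>H\<close>, where
  \<open>S X = (A\<^sup>-\<^sup>1 (- X' + A \<Pi> X), X(T))\<close> and \<open>\<Pi>\<close> is the \<open>L\<^sup>2\<close> projection in time. Since
  \<open>X'\<close> has degree at most \<open>q\<close>, the cross term in \<open>|S X|\<^sup>2\<close> is \<open>-2 \<integral>(X', X)\<close>, whence
  \<open>|S X|\<^sup>2 = \<integral>|X'|\<^sub>-\<^sub>1\<^sup>2 + \<integral>|\<Pi> X|\<^sub>1\<^sup>2 + |X(0)|\<^sup>2\<close>. Splitting \<open>X = \<Pi> X + (X - \<Pi> X)\<close> and using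
  \<open>|X - \<Pi> X|\<^sub>-\<^sub>1 \<le> k |X'|\<^sub>-\<^sub>1\<close> in \<open>L\<^sup>2\<close> bounds the functional \<open>F\<close> by the data times \<open>|S X|\<close>, so a
  Riesz argument on the closure of the range of \<open>S\<close> gives a solution with the required bound.
  For uniqueness, test a homogeneous solution with \<open>X(t) = \<integral>\<^sub>t\<^sup>T Y\<^sub>1\<close>, which yields
  \<open>\<integral>|Y\<^sub>1|\<^sub>H\<^sup>2 + a(X(0), X(0)) / 2 = 0\<close>, and then with constants.
\<close>

subsection \<open>Minimizing sequences of quadratic functionals\<close>

text \<open>This replaces the Riesz representation theorem: \<open>G\<close> with the form \<open>B\<close> is a pre-Hilbert space,
  possibly degenerate, \<open>comb x c y\<close> stands for \<open>x + c y\<close>, and the minimized functional is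
  \<open>B x x - 2 L x\<close>.\<close>

lemma minimizing_sequence:
  fixes B :: "'x \<Rightarrow> 'x \<Rightarrow> real" and L :: "'x \<Rightarrow> real" and comb :: "'x \<Rightarrow> real \<Rightarrow> 'x \<Rightarrow> 'x"
  assumes ne: "G \<noteq> {}"
    and comb: "\<And>x y c. x \<in> G \<Longrightarrow> y \<in> G \<Longrightarrow> comb x c y \<in> G"
    and Lc: "\<And>x y c. x \<in> G \<Longrightarrow> y \<in> G \<Longrightarrow> L (comb x c y) = L x + c * L y"
    and Bc: "\<And>x y z c. x \<in> G \<Longrightarrow> y \<in> G \<Longrightarrow> z \<in> G \<Longrightarrow> B (comb x c y) z = B x z + c * B y z"
    and sym: "\<And>x y. B x y = B y x"
    and pos: "\<And>x. 0 \<le> B x x"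
    and bound: "\<And>x. x \<in> G \<Longrightarrow> 2 * L x \<le> M + B x x"
  shows "\<exists>X. (\<forall>n. X n \<in> G)
      \<and> (\<forall>e>0. \<exists>n0. \<forall>m\<ge>n0. \<forall>n\<ge>n0. B (comb (X m) (-1) (X n)) (comb (X m) (-1) (X n)) < e)
      \<and> (\<forall>x\<in>G. (\<lambda>n. B (X n) x) \<longlonglongrightarrow> L x)"
proof -
  define J where "J x = B x x - 2 * L x" for x
  define m where "m = Inf (J ` G)"
  have bdd: "bdd_below (J ` G)"
    using bound by (intro bdd_belowI[of _ "-M"]) (force simp: J_def)
  have mJ: "m \<le> J x" if "x \<in> G" for x
    unfolding m_def using bdd that by (intro cINF_lower)
  have "\<exists>x\<in>G. J x < m + 1 / real (Suc n)" for n
    using cInf_lessD[of "J ` G" "m + 1 / real (Suc n)"] ne unfolding m_def[symmetric] by auto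
  then obtain X where XG: "\<And>n. X n \<in> G" and XJ: "\<And>n. J (X n) < m + 1 / real (Suc n)"
    by metis
  have Bc2: "B z (comb x c y) = B z x + c * B z y" if "x \<in> G" "y \<in> G" "z \<in> G" for x y z c
    using Bc[OF that] by (simp add: sym)
  have Bcc: "B (comb x c y) (comb x c y) = B x x + 2 * c * B x y + c\<^sup>2 * B y y"
    if "x \<in> G" "y \<in> G" for x y c
  proof -
    have "B (comb x c y) (comb x c y) = B x (comb x c y) + c * B y (comb x c y)"
      by (intro Bc that comb)
    also have "\<dots> = B x x + 2 * c * B x y + c\<^sup>2 * B y y"
      using that by (simp add: Bc2 sym[of y x] algebra_simps power2_eq_square)
    finally show ?thesis .
  qed
  have near: "B (comb x (-1) y) (comb x (-1) y) \<le> 2 * (J x - m) + 2 * (J y - m)"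
    if "x \<in> G" "y \<in> G" for x y
  proof -
    have d: "comb y (-1) x \<in> G" using comb that by blast
    \<comment> \<open>The midpoint of \<open>x\<close> and \<open>y\<close> lies in
      \<open>G\<close>, so its value is at least \<open>m\<close>; by the parallelogram law the
      excesses of \<open>J\<close> then bound the distance.\<close>
    have "m \<le> J (comb x (1/2) (comb y (-1) x))"
      by (intro mJ comb that d)
    also have "\<dots> = (B x x + B y y + 2 * B x y) / 4 - (L x + L y)"
      unfolding J_def Bcc[OF that(1) d] Bcc[OF that(2,1)] Bc2[OF that(2,1,1)]
        Lc[OF that(1) d] Lc[OF that(2,1)]
      by (simp add: sym[of y x] power2_eq_square field_simps)
    finally show ?thesis
      unfolding Bcc[OF that] J_def by (simp add: field_simps)
  qed
  have small: "eventually (\<lambda>n. 1 / real (Suc n) < e) sequentially" if "e > 0" for e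
    by (rule order_tendstoD(2)[OF LIMSEQ_Suc[OF lim_1_over_n] that])
  have cauchy: "\<exists>n0. \<forall>m\<ge>n0. \<forall>n\<ge>n0. B (comb (X m) (-1) (X n)) (comb (X m) (-1) (X n)) < e"
    if e: "e > 0" for e
  proof -
    obtain n0 where n0: "\<And>n. n \<ge> n0 \<Longrightarrow> 1 / real (Suc n) < e / 4"
      using small[of "e/4"] e by (auto simp: eventually_sequentially)
    have "B (comb (X i) (-1) (X j)) (comb (X i) (-1) (X j)) < e" if "i \<ge> n0" "j \<ge> n0" for i j
    proof -
      have "J (X n) - m < e / 4" if "n \<ge> n0" for n
        using XJ[of n] n0[OF that] by argo
      from this[OF that(1)] this[OF that(2)] near[OF XG XG, of i j] show ?thesis by argo
    qed
    then show ?thesis by blast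
  qed
  have lim: "(\<lambda>n. B (X n) x) \<longlonglongrightarrow> L x" if "x \<in> G" for x
  proof -
    define b where "b = B x x"
    have b: "b \<ge> 0" using pos b_def by simp
    have sq: "(B (X n) x - L x)\<^sup>2 \<le> (b + 1) * (1 / real (Suc n))" for n
    proof -
      define g where "g = B (X n) x - L x"
      \<comment> \<open>A step \<open>t\<close> in direction \<open>x\<close> cannot push
        \<open>J\<close> below \<open>m\<close>, and this \<open>t\<close> minimizes
        \<open>2 * t * g + t^2 * (b + 1)\<close>. Using \<open>b + 1\<close> for \<open>b\<close>
        covers degenerate directions with \<open>b = 0\<close>.\<close>
      define t where "t = - g / (b + 1)"
      have "m \<le> J (comb (X n) t x)" by (intro mJ comb XG that)
      also have "\<dots> = J (X n) + 2 * t * g + t\<^sup>2 * b"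
        unfolding J_def Bcc[OF XG that] Lc[OF XG that] g_def b_def by (simp add: algebra_simps)
      finally have "0 \<le> 1 / real (Suc n) + 2 * t * g + t\<^sup>2 * b" using XJ[of n] by linarith
      moreover have "t\<^sup>2 * b \<le> t\<^sup>2 * (b + 1)" by (intro mult_left_mono) auto
      moreover have "t * (b + 1) = - g" using b by (simp add: t_def)
      then have "t\<^sup>2 * (b + 1) = - t * g" by (metis mult.assoc mult_minus_left mult_minus_right power2_eq_square)
      ultimately have "- t * g \<le> 1 / real (Suc n)" by linarith
      then have "g\<^sup>2 / (b + 1) \<le> 1 / real (Suc n)" by (simp add: t_def power2_eq_square)
      then show ?thesis using b by (simp add: g_def pos_divide_le_eq mult.commute)
    qed
    have "(\<lambda>n. (b + 1) * (1 / real (Suc n))) \<longlonglongrightarrow> (b + 1) * 0"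
      by (rule tendsto_mult[OF tendsto_const LIMSEQ_Suc[OF lim_1_over_n]])
    then have up: "(\<lambda>n. (b + 1) * (1 / real (Suc n))) \<longlonglongrightarrow> 0" by simp
    have "(\<lambda>n. (B (X n) x - L x)\<^sup>2) \<longlonglongrightarrow> 0"
      by (rule tendsto_sandwich[OF _ _ tendsto_const up]; rule always_eventually)
         (use sq in \<open>simp_all del: of_nat_Suc\<close>)
    then have "(\<lambda>n. sqrt ((B (X n) x - L x)\<^sup>2)) \<longlonglongrightarrow> sqrt 0" by (rule tendsto_real_sqrt)
    then have "(\<lambda>n. B (X n) x - L x) \<longlonglongrightarrow> 0" by (simp add: tendsto_rabs_zero_iff)
    then show ?thesis by (simp add: LIM_zero_iff)
  qed
  show ?thesis using XG cauchy lim by blast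
qed

subsection \<open>Vector-valued polynomials and orthonormal bases\<close>

text \<open>The set is a parameter so that one predicate serves the open intervals of
  \<open>Y_space\<close>, the closed ones of \<open>X_space\<close>, and global polynomials, where
  calculus is free of endpoint conditions.\<close>

definition vpoly :: "nat \<Rightarrow> real set \<Rightarrow> (real \<Rightarrow> 'v::real_vector) \<Rightarrow> bool" where
  "vpoly n S g \<longleftrightarrow> (\<exists>c. \<forall>s\<in>S. g s = (\<Sum>j\<le>n. s ^ j *\<^sub>R c j))"

text \<open>The second clause puts the monomials up to degree \<open>q\<close> in the span of the
  family; this is what lets a polynomial be expanded in it.\<close>

definition orthonormal_polys :: "nat \<Rightarrow> real \<Rightarrow> real \<Rightarrow> (nat \<Rightarrow> real \<Rightarrow> real) \<Rightarrow> bool" where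
  "orthonormal_polys q l r p \<longleftrightarrow>
     (\<forall>j\<le>q. vpoly q UNIV (p j))
   \<and> (\<forall>j\<le>q. \<exists>c. \<forall>s. s ^ j = (\<Sum>i\<le>q. c i * p i s))
   \<and> (\<forall>i\<le>q. \<forall>j\<le>q. ((\<lambda>s. p i s * p j s) has_integral (if i = j then 1 else 0)) {l..r})"

text \<open>For an orthonormal family \<open>p\<close> these are the coordinates of the
  \<open>L^2\<close> projection of \<open>g\<close> in time, also when \<open>g\<close> lies outside
  the span.\<close>

definition coef :: "(nat \<Rightarrow> real \<Rightarrow> real) \<Rightarrow> real \<Rightarrow> real \<Rightarrow> (real \<Rightarrow> 'v::real_normed_vector) \<Rightarrow> nat \<Rightarrow> 'v"
  where "coef p l r g j = integral {l..r} (\<lambda>s. p j s *\<^sub>R g s)"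

section \<open>Algebra and calculus of vector-valued polynomials\<close>

lemma vpoly_mono: "vpoly n S g" if 1: "vpoly m S' g" "m \<le> n" "S \<subseteq> S'"
proof -
  obtain c where c: "\<forall>s\<in>S'. g s = (\<Sum>j\<le>m. s ^ j *\<^sub>R c j)" using 1 unfolding vpoly_def by auto
  have "g s = (\<Sum>j\<le>n. s ^ j *\<^sub>R (if j \<le> m then c j else 0))" if "s \<in> S" for s
  proof -
    have "(\<Sum>j\<le>n. s ^ j *\<^sub>R (if j \<le> m then c j else 0)) = (\<Sum>j\<le>m. s ^ j *\<^sub>R c j)"
      using \<open>m \<le> n\<close> by (intro sum.mono_neutral_cong_right) auto
    then show ?thesis using c that \<open>S \<subseteq> S'\<close> by auto
  qed
  then show ?thesis
    unfolding vpoly_def by (intro exI[of _ "\<lambda>j. if j \<le> m then c j else 0"]) blast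
qed

lemma vpoly_cong: "vpoly n S g" if "vpoly n S h" "\<And>s. s \<in> S \<Longrightarrow> g s = h s"
  using that unfolding vpoly_def by auto

lemma vpoly_combine: "vpoly n S (\<lambda>s. g s + t *\<^sub>R h s)" if gh: "vpoly n S g" "vpoly n S h"
proof -
  obtain c d where c: "\<forall>s\<in>S. g s = (\<Sum>j\<le>n. s ^ j *\<^sub>R c j)" "\<forall>s\<in>S. h s = (\<Sum>j\<le>n. s ^ j *\<^sub>R d j)"
    using gh unfolding vpoly_def by blast
  have "g s + t *\<^sub>R h s = (\<Sum>j\<le>n. s ^ j *\<^sub>R (c j + t *\<^sub>R d j))" if "s \<in> S" for s
    using c that by (simp add: scaleR_sum_right sum.distrib scaleR_add_right mult.commute)
  then show ?thesis unfolding vpoly_def by (intro exI[of _ "\<lambda>j. c j + t *\<^sub>R d j"]) blast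
qed

lemma vpoly_const: "vpoly n S (\<lambda>s. v)"
  unfolding vpoly_def
proof (intro exI ballI)
  fix s :: real
  have "(\<Sum>j\<le>n. s ^ j *\<^sub>R (if j = 0 then v else 0)) = (\<Sum>j\<in>{0}. s ^ j *\<^sub>R (if j = 0 then v else 0))"
    by (rule sum.mono_neutral_right) auto
  then show "v = (\<Sum>j\<le>n. s ^ j *\<^sub>R (if j = 0 then v else 0))" by simp
qed

lemma vpoly_scaleR: "vpoly n S (\<lambda>s. p s *\<^sub>R v)" if p: "vpoly n S p"
proof -
  obtain c where c: "\<forall>s\<in>S. p s = (\<Sum>j\<le>n. s ^ j *\<^sub>R c j)" using p unfolding vpoly_def by auto
  show ?thesis unfolding vpoly_def
    by (intro exI[of _ "\<lambda>j. c j *\<^sub>R v"]) (use c in \<open>auto simp: scaleR_sum_left\<close>)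
qed

lemma vpoly_sum: "vpoly n S (\<lambda>s. \<Sum>i\<in>I. g i s)" if "finite I" "\<And>i. i \<in> I \<Longrightarrow> vpoly n S (g i)"
  using that
proof (induction I rule: finite_induct)
  case empty
  then show ?case by (simp add: vpoly_const)
next
  case (insert x F)
  then show ?case
    using vpoly_combine[where t = 1, of n S "g x" "\<lambda>s. \<Sum>i\<in>F. g i s"] by simp
qed

lemma vpoly_extend:
  assumes "vpoly n S g"
  obtains P where "vpoly n UNIV P" "\<And>s. s \<in> S \<Longrightarrow> g s = P s"
proof -
  obtain c where "\<forall>s\<in>S. g s = (\<Sum>j\<le>n. s ^ j *\<^sub>R c j)" using assms unfolding vpoly_def by auto
  then show thesis by (intro that[of "\<lambda>s. \<Sum>j\<le>n. s ^ j *\<^sub>R c j"]) (auto simp: vpoly_def)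
qed

lemma vpoly_continuous_on:
  fixes P :: "real \<Rightarrow> 'v::real_normed_vector"
  assumes "vpoly n UNIV P" shows "continuous_on S P"
proof -
  obtain c where "\<forall>s. P s = (\<Sum>j\<le>n. s ^ j *\<^sub>R c j)" using assms unfolding vpoly_def by auto
  then have "P = (\<lambda>s. \<Sum>j\<le>n. s ^ j *\<^sub>R c j)" by auto
  then show ?thesis by (auto intro!: continuous_intros)
qed

lemma vpoly_deriv:
  fixes P :: "real \<Rightarrow> 'v::real_normed_vector"
  assumes "vpoly (Suc n) UNIV P"
  obtains P' where "vpoly n UNIV P'" "\<And>s S. (P has_vector_derivative P' s) (at s within S)"
proof -
  obtain c where c: "\<forall>s. P s = (\<Sum>j\<le>Suc n. s ^ j *\<^sub>R c j)" using assms unfolding vpoly_def by auto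
  then have P: "P = (\<lambda>s. c 0 + (\<Sum>j\<le>n. s ^ Suc j *\<^sub>R c (Suc j)))"
    by (auto simp: sum.atMost_Suc_shift simp del: sum.atMost_Suc)
  show thesis
  proof (rule that[of "\<lambda>s. \<Sum>j\<le>n. s ^ j *\<^sub>R (real (Suc j) *\<^sub>R c (Suc j))"])
    show "vpoly n UNIV (\<lambda>s. \<Sum>j\<le>n. s ^ j *\<^sub>R (real (Suc j) *\<^sub>R c (Suc j)))"
      unfolding vpoly_def by (intro exI[of _ "\<lambda>j. real (Suc j) *\<^sub>R c (Suc j)"]) blast
    have 1: "((\<lambda>s. s ^ Suc j *\<^sub>R c (Suc j)) has_vector_derivative s ^ j *\<^sub>R (real (Suc j) *\<^sub>R c (Suc j)))
        (at s within S)" for j s S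
      by (rule has_vector_derivative_eq_rhs, rule has_vector_derivative_scaleR, rule DERIV_power[OF DERIV_ident])
         (auto intro: derivative_eq_intros simp: mult.commute)
    show "(P has_vector_derivative (\<Sum>j\<le>n. s ^ j *\<^sub>R (real (Suc j) *\<^sub>R c (Suc j)))) (at s within S)" for s S
      unfolding P
      using has_vector_derivative_add[OF has_vector_derivative_const has_vector_derivative_sum[OF 1]]
      by simp
  qed
qed

lemma vpoly_antideriv:
  fixes P :: "real \<Rightarrow> 'v::real_normed_vector"
  assumes "vpoly n UNIV P"
  obtains Q where "vpoly (Suc n) UNIV Q" "\<And>s S. (Q has_vector_derivative P s) (at s within S)"
proof -
  obtain c where c: "\<forall>s. P s = (\<Sum>j\<le>n. s ^ j *\<^sub>R c j)" using assms unfolding vpoly_def by auto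
  define d where "d j = (case j of 0 \<Rightarrow> 0 | Suc i \<Rightarrow> c i /\<^sub>R real (Suc i))" for j
  define Q where "Q s = (\<Sum>j\<le>n. s ^ Suc j *\<^sub>R (c j /\<^sub>R real (Suc j)))" for s
  show thesis
  proof (rule that[of Q])
    have "Q s = (\<Sum>j\<le>Suc n. s ^ j *\<^sub>R d j)" for s
      by (simp add: sum.atMost_Suc_shift d_def Q_def del: sum.atMost_Suc)
    then show "vpoly (Suc n) UNIV Q" unfolding vpoly_def by blast
    have 1: "((\<lambda>s. s ^ Suc j *\<^sub>R (c j /\<^sub>R real (Suc j))) has_vector_derivative s ^ j *\<^sub>R c j)
        (at s within S)" for j s S
      by (rule has_vector_derivative_eq_rhs, rule has_vector_derivative_scaleR, rule DERIV_power[OF DERIV_ident])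
         (auto intro: derivative_eq_intros simp del: of_nat_Suc)
    show "(Q has_vector_derivative P s) (at s within S)" for s S
      using has_vector_derivative_sum[where I = "{..n}", OF 1] c unfolding Q_def by simp
  qed
qed

text \<open>The two nodes form a null set. This matters because \<open>Y_space\<close> leaves the
  values there free and a piecewise polynomial need not be differentiable there.\<close>

lemma has_integral_interior_cong:
  fixes f :: "real \<Rightarrow> 'v::real_normed_vector"
  assumes "(f has_integral y) {l..r}" "\<And>s. s \<in> {l<..<r} \<Longrightarrow> g s = f s"
  shows "(g has_integral y) {l..r}"
  by (rule has_integral_spike_finite[OF _ _ assms(1), of "{l, r}"]) (use assms(2) in auto)

lemma integrable_scaleR_vpoly:
  fixes g :: "real \<Rightarrow> 'v::real_normed_vector"
  assumes "continuous_on {l..r} \<phi>" "vpoly n {l<..<r} g"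
  shows "(\<lambda>s. \<phi> s *\<^sub>R g s) integrable_on {l..r}"
proof -
  obtain c where c: "\<forall>s\<in>{l<..<r}. g s = (\<Sum>j\<le>n. s ^ j *\<^sub>R c j)" using assms unfolding vpoly_def by auto
  have "(\<lambda>s. (\<phi> s * s ^ j) *\<^sub>R c j) integrable_on {l..r}" for j
    by (rule integrable_on_scaleR_left, rule integrable_continuous_real)
       (intro continuous_intros assms)
  then have "(\<lambda>s. \<Sum>j\<le>n. (\<phi> s * s ^ j) *\<^sub>R c j) integrable_on {l..r}"
    by (intro integrable_sum) auto
  then obtain y where "((\<lambda>s. \<Sum>j\<le>n. (\<phi> s * s ^ j) *\<^sub>R c j) has_integral y) {l..r}"
    by (auto simp: integrable_on_def)
  then have "((\<lambda>s. \<phi> s *\<^sub>R g s) has_integral y) {l..r}"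
    by (rule has_integral_interior_cong) (use c in \<open>auto simp: scaleR_sum_right\<close>)
  then show ?thesis by (auto simp: integrable_on_def)
qed

text \<open>Gram-Schmidt by induction on the degree: subtract from the next monomial its projection
  onto the earlier polynomials and normalize the remainder.\<close>

lemma ex_orthonormal_polys:
  assumes "l < r"
  shows "\<exists>p. orthonormal_polys q l r p"
proof (induction q)
  case 0
  let ?k = "1 / sqrt (r - l)"
  have "((\<lambda>s. ?k * ?k) has_integral (r - l) * (?k * ?k)) {l..r}"
    using has_integral_const_real[of "?k * ?k" l r] assms by simp
  moreover have "(r - l) * (?k * ?k) = 1" using assms by simp
  moreover have "1 = sqrt (r - l) * ?k" using assms by simp
  ultimately show ?case
    unfolding orthonormal_polys_def
    by (intro exI[of _ "\<lambda>_ _. ?k"]) (auto simp: vpoly_const intro: exI[of _ "\<lambda>_. sqrt (r - l)"])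
next
  case (Suc q)
  then obtain p where p: "\<And>j. j \<le> q \<Longrightarrow> vpoly q UNIV (p j)"
    and sp: "\<And>j. j \<le> q \<Longrightarrow> \<exists>c. \<forall>s. s ^ j = (\<Sum>i\<le>q. c i * p i s)"
    and orth: "\<And>i j. i \<le> q \<Longrightarrow> j \<le> q \<Longrightarrow> ((\<lambda>s. p i s * p j s) has_integral (if i = j then 1 else 0)) {l..r}"
    unfolding orthonormal_polys_def by blast
  have cont: "continuous_on S (p j)" if "j \<le> q" for S j
    by (rule vpoly_continuous_on[OF p[OF that]])
  define c where "c i = integral {l..r} (\<lambda>s. s ^ Suc q * p i s)" for i
  define g where "g s = s ^ Suc q - (\<Sum>i\<le>q. c i * p i s)" for s
  have "vpoly q UNIV (\<lambda>s. \<Sum>i\<le>q. c i * p i s)"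
  proof (intro vpoly_sum)
    fix i assume "i \<in> {..q}"
    then show "vpoly q UNIV (\<lambda>s. c i * p i s)"
      using vpoly_combine[OF vpoly_const p, of i 0 "c i"] by auto
  qed simp
  then obtain e where e: "\<forall>s. (\<Sum>i\<le>q. c i * p i s) = (\<Sum>j\<le>q. s ^ j * e j)"
    unfolding vpoly_def by auto
  define d where "d j = (if j \<le> q then - e j else 1)" for j
  have gd: "g s = (\<Sum>j\<le>Suc q. d j * s ^ j)" for s
    by (simp add: g_def e d_def sum_negf mult.commute)
  have vg: "vpoly (Suc q) UNIV g"
    unfolding vpoly_def by (intro exI[of _ d]) (use gd in \<open>auto simp: mult.commute\<close>)
  have contg: "continuous_on S g" for S by (rule vpoly_continuous_on[OF vg])
  define n2 where "n2 = integral {l..r} (\<lambda>s. g s * g s)"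
  have n2i: "((\<lambda>s. g s * g s) has_integral n2) {l..r}"
    unfolding n2_def by (intro integrable_integral integrable_continuous_real continuous_intros contg)
  \<comment> \<open>The remainder \<open>g\<close> is monic of degree \<open>q + 1\<close>, hence
    has finitely many roots; norm zero would make it vanish on the whole interval.\<close>
  have "n2 > 0"
  proof (rule ccontr)
    assume "\<not> n2 > 0"
    moreover have "n2 \<ge> 0" using n2i by (rule has_integral_nonneg) auto
    ultimately have "n2 = 0" by simp
    have "g s * g s = 0" if "s \<in> cbox l r" for s
      by (rule has_integral_0_cbox_imp_0[of l r "\<lambda>s. g s * g s"])
         (use n2i \<open>n2 = 0\<close> assms that in \<open>auto intro!: continuous_intros contg\<close>)
    then have "{l..r} \<subseteq> {z. (\<Sum>j\<le>Suc q. d j * z ^ j) = 0}"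
      using gd by (auto simp del: sum.atMost_Suc)
    moreover have "finite {z. (\<Sum>j\<le>Suc q. d j * z ^ j) = 0}"
      unfolding polyfun_finite_roots by (intro exI[of _ "Suc q"]) (simp add: d_def)
    ultimately show False using infinite_Icc[OF assms] finite_subset by blast
  qed
  have gp: "((\<lambda>s. g s * p j s) has_integral 0) {l..r}" if "j \<le> q" for j
  proof -
    have "((\<lambda>s. s ^ Suc q * p j s) has_integral c j) {l..r}"
      unfolding c_def by (intro integrable_integral integrable_continuous_real continuous_intros cont that)
    moreover have "((\<lambda>s. \<Sum>i\<le>q. c i * (p i s * p j s)) has_integral (\<Sum>i\<le>q. c i * (if i = j then 1 else 0))) {l..r}"
      by (intro has_integral_sum has_integral_mult_right orth that) auto
    ultimately have "((\<lambda>s. s ^ Suc q * p j s - (\<Sum>i\<le>q. c i * (p i s * p j s))) has_integral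
        c j - (\<Sum>i\<le>q. c i * (if i = j then 1 else 0))) {l..r}"
      by (rule has_integral_diff)
    then show ?thesis using that
      by (simp add: g_def left_diff_distrib sum_distrib_right mult.assoc if_distrib sum.delta cong: if_cong)
  qed
  define p' where "p' = p(Suc q := \<lambda>s. g s / sqrt n2)"
  have p'_le: "p' j = p j" if "j \<le> q" for j using that by (simp add: p'_def)
  have p'_Suc: "p' (Suc q) = (\<lambda>s. g s / sqrt n2)" by (simp add: p'_def)
  have 1: "vpoly (Suc q) UNIV (p' j)" if "j \<le> Suc q" for j
  proof (cases "j = Suc q")
    case True
    then show ?thesis
      using vpoly_combine[OF vpoly_const vg, of 0 "1 / sqrt n2"] by (simp add: p'_Suc)
  next
    case False
    then show ?thesis using that p[of j] by (auto simp: p'_le intro: vpoly_mono)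
  qed
  have 2: "\<exists>c. \<forall>s. s ^ j = (\<Sum>i\<le>Suc q. c i * p' i s)" if j: "j \<le> Suc q" for j
  proof (cases "j = Suc q")
    case True
    \<comment> \<open>The definition of \<open>g\<close> solved for the monomial;
      \<open>sqrt n2\<close> undoes the normalization.\<close>
    have "s ^ j = (\<Sum>i\<le>Suc q. (if i \<le> q then c i else sqrt n2) * p' i s)" for s
      using \<open>n2 > 0\<close> by (simp add: True p'_le p'_Suc g_def)
    then show ?thesis by (intro exI[of _ "\<lambda>i. if i \<le> q then c i else sqrt n2"] allI)
  next
    case False
    then obtain c where c: "\<forall>s. s ^ j = (\<Sum>i\<le>q. c i * p i s)" using sp[of j] j by auto
    have "s ^ j = (\<Sum>i\<le>Suc q. (if i \<le> q then c i else 0) * p' i s)" for s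
      using c by (simp add: p'_le)
    then show ?thesis by (intro exI[of _ "\<lambda>i. if i \<le> q then c i else 0"] allI)
  qed
  have 3: "((\<lambda>s. p' i s * p' j s) has_integral (if i = j then 1 else 0)) {l..r}"
    if "i \<le> Suc q" "j \<le> Suc q" for i j
  proof -
    have *: "((\<lambda>s. g s / sqrt n2 * p j s) has_integral 0) {l..r}" if "j \<le> q" for j
      using has_integral_mult_right[OF gp[OF that], of "1 / sqrt n2"] by simp
    have **: "((\<lambda>s. g s / sqrt n2 * (g s / sqrt n2)) has_integral 1) {l..r}"
      using has_integral_mult_right[OF n2i, of "1 / n2"] \<open>n2 > 0\<close> by simp
    consider "i \<le> q" "j \<le> q" | "i = Suc q" "j \<le> q" | "i \<le> q" "j = Suc q" | "i = Suc q" "j = Suc q"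
      using \<open>i \<le> Suc q\<close> \<open>j \<le> Suc q\<close> by linarith
    then show ?thesis
    proof cases
      case 1 then show ?thesis using orth by (simp add: p'_le)
    next
      case 2 then show ?thesis using *[of j] by (simp add: p'_le p'_Suc)
    next
      case 3 then show ?thesis using *[of i] by (simp add: p'_le p'_Suc mult.commute)
    next
      case 4 then show ?thesis using ** by (simp add: p'_Suc)
    qed
  qed
  show ?case unfolding orthonormal_polys_def by (intro exI[of _ p'] conjI allI impI 1 2 3)
qed

subsection \<open>Expansion on one interval\<close>

lemma coef_cong:
  assumes "\<And>s. s \<in> {l<..<r} \<Longrightarrow> g s = h s"
  shows "coef p l r g j = coef p l r h j"
  unfolding coef_def by (rule integral_spike[of "{l, r}"]) (use assms in auto)

locale interval_basis =
  fixes q :: nat and l r :: real and p :: "nat \<Rightarrow> real \<Rightarrow> real"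
  assumes lr: "l < r" and orthonormal_polys: "orthonormal_polys q l r p"
begin

lemma vpoly_basis: "vpoly q UNIV (p j)" if "j \<le> q"
  using orthonormal_polys that unfolding orthonormal_polys_def by blast

lemma cont_basis: "continuous_on S (p j)" if "j \<le> q"
  by (rule vpoly_continuous_on[OF vpoly_basis[OF that]])

lemma orth: "((\<lambda>s. p i s * p j s) has_integral (if i = j then 1 else 0)) {l..r}" if "i \<le> q" "j \<le> q"
  using orthonormal_polys that unfolding orthonormal_polys_def by blast

section \<open>Coordinates in the orthonormal basis\<close>

lemma coef_has_integral:
  fixes g :: "real \<Rightarrow> 'v::real_normed_vector"
  assumes "vpoly n {l<..<r} g" "j \<le> q"
  shows "((\<lambda>s. p j s *\<^sub>R g s) has_integral coef p l r g j) {l..r}"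
  unfolding coef_def
  by (intro integrable_integral integrable_scaleR_vpoly[OF _ assms(1)] cont_basis assms(2))

lemma coef_basis_sum:
  fixes y :: "nat \<Rightarrow> 'v::real_normed_vector"
  assumes "\<And>s. s \<in> {l<..<r} \<Longrightarrow> g s = (\<Sum>i\<le>q. p i s *\<^sub>R y i)" "j \<le> q"
  shows "coef p l r g j = y j"
proof -
  have "((\<lambda>s. \<Sum>i\<le>q. (p j s * p i s) *\<^sub>R y i) has_integral
      (\<Sum>i\<le>q. (if j = i then 1 else 0) *\<^sub>R y i)) {l..r}"
    by (intro has_integral_sum has_integral_scaleR_left orth assms) auto
  moreover have "(\<Sum>i\<le>q. (if j = i then 1 else 0) *\<^sub>R y i) = y j"
    using \<open>j \<le> q\<close> by (simp add: if_distrib[of "\<lambda>t. t *\<^sub>R _"] sum.delta' cong: if_cong)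
  ultimately have "((\<lambda>s. \<Sum>i\<le>q. (p j s * p i s) *\<^sub>R y i) has_integral y j) {l..r}" by simp
  then have "((\<lambda>s. p j s *\<^sub>R g s) has_integral y j) {l..r}"
    by (rule has_integral_interior_cong) (use assms in \<open>auto simp: scaleR_sum_right\<close>)
  then show ?thesis unfolding coef_def by (rule integral_unique)
qed

lemma vpoly_basis_sum: "vpoly q S (\<lambda>s. \<Sum>j\<le>q. p j s *\<^sub>R y j)"
  by (intro vpoly_sum vpoly_scaleR vpoly_mono[OF vpoly_basis order_refl subset_UNIV]) auto

lemma coef_expand:
  fixes g :: "real \<Rightarrow> 'v::real_normed_vector"
  assumes "vpoly q {l<..<r} g" "s \<in> {l<..<r}"
  shows "g s = (\<Sum>j\<le>q. p j s *\<^sub>R coef p l r g j)"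
proof -
  obtain c where c: "\<And>s. s \<in> {l<..<r} \<Longrightarrow> g s = (\<Sum>j\<le>q. s ^ j *\<^sub>R c j)"
    using assms unfolding vpoly_def by auto
  have "\<forall>j\<le>q. \<exists>c. \<forall>s. s ^ j = (\<Sum>i\<le>q. c i * p i s)" using orthonormal_polys unfolding orthonormal_polys_def by auto
  then obtain d where d: "\<And>j s. j \<le> q \<Longrightarrow> s ^ j = (\<Sum>i\<le>q. d j i * p i s)" by metis
  \<comment> \<open>Expanding each monomial in the basis and exchanging the sums gives these
    coordinates; orthonormality then identifies them with \<open>coef\<close>.\<close>
  define y where "y i = (\<Sum>j\<le>q. d j i *\<^sub>R c j)" for i
  have gy: "g s = (\<Sum>i\<le>q. p i s *\<^sub>R y i)" if "s \<in> {l<..<r}" for s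
  proof -
    have "g s = (\<Sum>j\<le>q. \<Sum>i\<le>q. (p i s * d j i) *\<^sub>R c j)"
      unfolding c[OF that] by (intro sum.cong refl) (simp add: d scaleR_sum_left mult.commute)
    also have "\<dots> = (\<Sum>i\<le>q. \<Sum>j\<le>q. (p i s * d j i) *\<^sub>R c j)" by (rule sum.swap)
    finally show ?thesis by (simp add: y_def scaleR_sum_right)
  qed
  have "coef p l r g j = y j" if "j \<le> q" for j by (rule coef_basis_sum[OF gy that])
  then show ?thesis using gy[OF assms(2)] by simp
qed

lemma coef_combine:
  fixes g h :: "real \<Rightarrow> 'v::real_normed_vector"
  assumes "vpoly m {l<..<r} g" "vpoly n {l<..<r} h" "j \<le> q"
  shows "coef p l r (\<lambda>s. g s + t *\<^sub>R h s) j = coef p l r g j + t *\<^sub>R coef p l r h j"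
proof -
  have "((\<lambda>s. p j s *\<^sub>R g s + t *\<^sub>R (p j s *\<^sub>R h s)) has_integral coef p l r g j + t *\<^sub>R coef p l r h j) {l..r}"
    by (intro has_integral_add has_integral_cmul coef_has_integral[OF assms(1)] coef_has_integral[OF assms(2)] assms)
  then have "((\<lambda>s. p j s *\<^sub>R (g s + t *\<^sub>R h s)) has_integral coef p l r g j + t *\<^sub>R coef p l r h j) {l..r}"
    by (simp add: scaleR_add_right mult.commute)
  then show ?thesis unfolding coef_def[of _ _ _ "\<lambda>s. g s + t *\<^sub>R h s"] by (rule integral_unique)
qed

text \<open>A Parseval identity in which only \<open>h\<close> has to lie in the span: the part of
  \<open>g\<close> orthogonal to the basis contributes nothing. This lets test functions of degree
  \<open>q + 1\<close> be paired with trial functions of degree \<open>q\<close>.\<close>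

lemma has_integral_bilinear_sum:
  fixes g :: "real \<Rightarrow> 'v::real_normed_vector" and y :: "nat \<Rightarrow> 'w::real_normed_vector"
    and b :: "'v \<Rightarrow> 'w \<Rightarrow> real"
  assumes b: "bounded_bilinear b" and g: "vpoly n {l<..<r} g"
    and h: "\<And>s. s \<in> {l<..<r} \<Longrightarrow> h s = (\<Sum>j\<le>q. p j s *\<^sub>R y j)"
  shows "((\<lambda>s. b (g s) (h s)) has_integral (\<Sum>j\<le>q. b (coef p l r g j) (y j))) {l..r}"
proof -
  interpret b: bounded_bilinear b by (rule b)
  have "((\<lambda>s. b (p j s *\<^sub>R g s) (y j)) has_integral b (coef p l r g j) (y j)) {l..r}" if "j \<le> q" for j
    using has_integral_linear[OF coef_has_integral[OF g that] b.bounded_linear_left] by (simp add: o_def)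
  then have "((\<lambda>s. \<Sum>j\<le>q. b (p j s *\<^sub>R g s) (y j)) has_integral (\<Sum>j\<le>q. b (coef p l r g j) (y j))) {l..r}"
    by (intro has_integral_sum) auto
  then show ?thesis
    by (rule has_integral_interior_cong) (simp add: h b.sum_right b.scaleR_left b.scaleR_right)
qed

text \<open>Because \<open>P'\<close> lies in the span, the sum is the integral of
  \<open>b P P'\<close>, which is half the derivative of \<open>b P P\<close>. \<open>P\<close>
  itself may have higher degree.\<close>

lemma sum_coef_deriv:
  fixes P P' :: "real \<Rightarrow> 'v::real_normed_vector"
  assumes b: "bounded_bilinear b" and sym: "\<And>u v. b u v = b v u"
    and P: "vpoly n UNIV P" and P': "vpoly q UNIV P'"
    and d: "\<And>s S. (P has_vector_derivative P' s) (at s within S)"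
  shows "(\<Sum>j\<le>q. b (coef p l r P j) (coef p l r P' j)) = (b (P r) (P r) - b (P l) (P l)) / (2::real)"
proof -
  interpret b: bounded_bilinear b by (rule b)
  have "((\<lambda>s. b (P s) (P' s) + b (P' s) (P s)) has_integral (b (P r) (P r) - b (P l) (P l))) {l..r}"
    using lr by (intro fundamental_theorem_of_calculus b.has_vector_derivative d) auto
  then have "((\<lambda>s. 1 / 2 * (b (P s) (P' s) + b (P' s) (P s))) has_integral 1 / 2 * (b (P r) (P r) - b (P l) (P l))) {l..r}"
    by (rule has_integral_mult_right)
  then have "((\<lambda>s. b (P s) (P' s)) has_integral (b (P r) (P r) - b (P l) (P l)) / 2) {l..r}"
    by (simp add: sym[of "P' _"])
  moreover have "((\<lambda>s. b (P s) (P' s)) has_integral (\<Sum>j\<le>q. b (coef p l r P j) (coef p l r P' j))) {l..r}"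
    by (rule has_integral_bilinear_sum[OF b vpoly_mono[OF P order_refl subset_UNIV]
          coef_expand[OF vpoly_mono[OF P' order_refl subset_UNIV]]])
  ultimately show ?thesis by (rule has_integral_unique[rotated])
qed

text \<open>The projection is a best approximation for the possibly degenerate form
  \<open>b\<close>, so the error is at most that of the constant \<open>P l\<close>, and
  \<open>P - P l\<close> is bounded pointwise through the integral of \<open>P'\<close>. The form
  stays abstract so that it can later be the inner product of the dual space.\<close>

lemma projection_error:
  fixes P P' :: "real \<Rightarrow> 'v::real_normed_vector" and b :: "'v \<Rightarrow> 'v \<Rightarrow> real"
  assumes b: "bounded_bilinear b" and sym: "\<And>u v. b u v = b v u" and pos: "\<And>u. 0 \<le> b u u"
    and P: "vpoly n UNIV P" and P': "vpoly q UNIV P'"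
    and d: "\<And>s S. (P has_vector_derivative P' s) (at s within S)"
  defines "E \<equiv> \<lambda>s. P s - (\<Sum>j\<le>q. p j s *\<^sub>R coef p l r P j)"
  shows "integral {l..r} (\<lambda>s. b (E s) (E s)) \<le> (r - l)\<^sup>2 * (\<Sum>j\<le>q. b (coef p l r P' j) (coef p l r P' j))"
proof -
  interpret b: bounded_bilinear b by (rule b)
  define D where "D = (\<Sum>j\<le>q. b (coef p l r P' j) (coef p l r P' j))"
  \<comment> \<open>Projection minus constant, a polynomial of degree at most \<open>q\<close>: thus
    \<open>P - P l = E + G\<close> with \<open>E\<close> orthogonal to \<open>G\<close>.\<close>
  define G where "G s = (\<Sum>j\<le>q. p j s *\<^sub>R coef p l r P j) - P l" for s
  define N where "N = max n q"
  have vS: "vpoly N UNIV (\<lambda>s. \<Sum>j\<le>q. p j s *\<^sub>R coef p l r P j)"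
    by (rule vpoly_mono[OF vpoly_basis_sum _ order_refl]) (simp add: N_def)
  have vP: "vpoly N UNIV P" by (rule vpoly_mono[OF P _ order_refl]) (simp add: N_def)
  have vE: "vpoly N UNIV E"
    using vpoly_combine[OF vP vS, of "-1"] by (simp add: E_def)
  have vG: "vpoly q UNIV G"
    using vpoly_combine[OF vpoly_basis_sum vpoly_const, of UNIV "coef p l r P" "-1" "P l"] by (simp add: G_def[abs_def])
  have coefE: "coef p l r E j = 0" if "j \<le> q" for j
  proof -
    have "coef p l r E j = coef p l r P j - coef p l r (\<lambda>s. \<Sum>j\<le>q. p j s *\<^sub>R coef p l r P j) j"
      using coef_combine[OF vpoly_mono[OF P order_refl subset_UNIV] vpoly_basis_sum that, of "-1"]
      by (simp add: E_def)
    then show ?thesis using coef_basis_sum[OF refl that, where y = "coef p l r P"] by simp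
  qed
  have cE: "continuous_on S E" and cG: "continuous_on S G" and cP: "continuous_on S P"
    and cP': "continuous_on S P'" for S
    by (rule vpoly_continuous_on vE vG P P')+
  have "((\<lambda>s. b (E s) (G s)) has_integral (\<Sum>j\<le>q. b (coef p l r E j) (coef p l r G j))) {l..r}"
    by (rule has_integral_bilinear_sum[OF b vpoly_mono[OF vE order_refl subset_UNIV]
          coef_expand[OF vpoly_mono[OF vG order_refl subset_UNIV]]])
  then have EG: "((\<lambda>s. b (E s) (G s)) has_integral 0) {l..r}"
    by (simp add: coefE b.zero_left)
  have DI: "((\<lambda>s. b (P' s) (P' s)) has_integral D) {l..r}"
    unfolding D_def
    by (rule has_integral_bilinear_sum[OF b vpoly_mono[OF P' order_refl subset_UNIV]
          coef_expand[OF vpoly_mono[OF P' order_refl subset_UNIV]]])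
  have pw: "b (P s - P l) (P s - P l) \<le> (r - l) * D" if s: "s \<in> {l..r}" for s
  proof (cases "s = l")
    case True
    have "0 \<le> D" using pos by (simp add: D_def sum_nonneg)
    then show ?thesis using lr by (simp add: True b.zero_left)
  next
    case False
    define w where "w = P s - P l"
    define h where "h = s - l"
    have h: "h > 0" "h \<le> r - l" using s False by (auto simp: h_def)
    have 1: "((\<lambda>t. b w (P' t)) has_integral b w (P s) - b w (P l)) {l..s}"
      using s by (intro fundamental_theorem_of_calculus b.bounded_linear_right[THEN bounded_linear.has_vector_derivative] d) auto
    have 2: "(\<lambda>t. b (P' t) (P' t)) integrable_on {l..s}"
      by (intro integrable_continuous_real b.continuous_on cP')
    have "2 * (b w w) = 2 * integral {l..s} (\<lambda>t. b w (P' t))"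
      using integral_unique[OF 1] by (simp add: w_def b.diff_right)
    also have "\<dots> = integral {l..s} (\<lambda>t. 2 * b w (P' t))" by simp
    \<comment> \<open>Young's inequality weighted by the length \<open>h\<close> of the interval:
      integrating \<open>b w w / h\<close> returns exactly one \<open>b w w\<close>, which the
      left-hand side absorbs.\<close>
    also have "\<dots> \<le> integral {l..s} (\<lambda>t. b w w / h + h * b (P' t) (P' t))"
    proof (rule integral_le)
      show "(\<lambda>t. 2 * b w (P' t)) integrable_on {l..s}"
        using 1 by (auto simp: integrable_on_def intro: has_integral_mult_right)
      show "(\<lambda>t. b w w / h + h * b (P' t) (P' t)) integrable_on {l..s}"
        by (intro integrable_continuous_real continuous_intros b.continuous_on cP')
      fix t
      have "0 \<le> b (w /\<^sub>R h - P' t) (w /\<^sub>R h - P' t) * h" using h pos by auto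
      also have "\<dots> = b w w / h + h * b (P' t) (P' t) - 2 * b w (P' t)"
        using h by (simp add: b.diff_left b.diff_right b.scaleR_left b.scaleR_right sym[of "P' t" w] field_simps)
      finally show "2 * b w (P' t) \<le> b w w / h + h * b (P' t) (P' t)" by simp
    qed
    also have "\<dots> = h * (b w w / h) + h * integral {l..s} (\<lambda>t. b (P' t) (P' t))"
      using 2 h by (subst integral_add) (auto simp: h_def intro: integrable_on_cmult_left)
    also have "\<dots> \<le> b w w + (r - l) * D"
    proof -
      have le: "integral {l..s} (\<lambda>t. b (P' t) (P' t)) \<le> D"
        unfolding integral_unique[OF DI, symmetric]
        using s pos DI by (intro integral_subset_le 2) (auto simp: integrable_on_def)
      have "h * integral {l..s} (\<lambda>t. b (P' t) (P' t)) \<le> (r - l) * D"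
        using h by (intro mult_mono le integral_nonneg 2 pos) auto
      then show ?thesis using h by simp
    qed
    finally show ?thesis by (simp add: w_def)
  qed
  \<comment> \<open>The cross term integrates to zero; adding it permits a pointwise comparison with
    the form at \<open>E + G\<close>.\<close>
  have "((\<lambda>s. b (E s) (E s) + 2 * b (E s) (G s)) has_integral integral {l..r} (\<lambda>s. b (E s) (E s)) + 2 * 0) {l..r}"
    by (intro has_integral_add has_integral_mult_right EG integrable_integral integrable_continuous_real
      b.continuous_on cE)
  then have "integral {l..r} (\<lambda>s. b (E s) (E s)) = integral {l..r} (\<lambda>s. b (E s) (E s) + 2 * b (E s) (G s))"
    by (simp add: integral_unique)
  also have "\<dots> \<le> integral {l..r} (\<lambda>s. (r - l) * D)"
  proof (rule integral_le)
    show "(\<lambda>s. b (E s) (E s) + 2 * b (E s) (G s)) integrable_on {l..r}"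
      by (intro integrable_continuous_real continuous_intros b.continuous_on cE cG)
    fix s assume s: "s \<in> {l..r}"
    have W: "P s - P l = E s + G s" by (simp add: E_def G_def)
    have "b (E s) (E s) + 2 * b (E s) (G s) \<le> b (E s) (E s) + 2 * b (E s) (G s) + b (G s) (G s)"
      using pos by simp
    also have "\<dots> = b (P s - P l) (P s - P l)"
      unfolding W by (simp add: b.add_left b.add_right sym[of "G s" "E s"])
    also have "\<dots> \<le> (r - l) * D" by (rule pw[OF s])
    finally show "b (E s) (E s) + 2 * b (E s) (G s) \<le> (r - l) * D" .
  qed (rule integrable_const_ivl)
  also have "\<dots> = (r - l)\<^sup>2 * D" using lr by (simp add: power2_eq_square)
  finally show ?thesis unfolding D_def .
qed

end

subsection \<open>Gelfand triples\<close>

locale gelfand =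
  fixes \<iota> :: "'v::{real_inner,complete_space,second_countable_topology}
               \<Rightarrow> 'h::{real_inner,complete_space,second_countable_topology}"
    and a :: "'v \<Rightarrow> 'v \<Rightarrow> real"
  assumes emb_lin: "bounded_linear \<iota>" and emb_inj: "inj \<iota>"
    and emb_dense: "closure (range \<iota>) = UNIV"
    and a_bdd: "bounded_bilinear a" and a_sym: "\<And>u v. a u v = a v u"
    and a_coerc: "\<exists>\<alpha>>0. \<forall>v. \<alpha> * (norm v)\<^sup>2 \<le> a v v"
begin

sublocale emb: bounded_linear \<iota> by (rule emb_lin)
sublocale a: bounded_bilinear a by (rule a_bdd)

lemma a_nonneg: "0 \<le> a u u"
  using a_coerc by (meson mult_nonneg_nonneg less_imp_le order_trans zero_le_power2)

lemma a_pos: "0 < a u u" if "u \<noteq> 0"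
proof -
  obtain \<alpha> where "\<alpha> > 0" "\<alpha> * (norm u)\<^sup>2 \<le> a u u" using a_coerc by blast
  moreover have "0 < \<alpha> * (norm u)\<^sup>2" using \<open>\<alpha> > 0\<close> that by simp
  ultimately show ?thesis by linarith
qed

lemma a_definite: "u = 0" if "a u u = 0"
  using a_pos[of u] that by force

lemma two_a_le: "2 * a u v \<le> a u u + a v v"
  using a_nonneg[of "u - v"] by (simp add: a.diff_left a.diff_right a_sym[of v u])

lemma emb_eq_0: "u = 0" if "\<iota> u = 0"
  using emb_inj that emb.zero by (metis injD)

lemma emb_bilinear: "bounded_bilinear (\<lambda>u v. \<iota> u \<bullet> \<iota> v)"
  using bounded_bilinear.comp[OF bounded_bilinear_inner emb_lin emb_lin] .

text \<open>Coercivity turns the energy-Cauchy sequences supplied by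
  \<open>minimizing_sequence\<close> into norm-Cauchy ones, to which completeness applies.\<close>

lemma a_Cauchy:
  assumes "\<And>e. e > 0 \<Longrightarrow> \<exists>n0. \<forall>m\<ge>n0. \<forall>n\<ge>n0. a (X m - X n) (X m - X n) < e"
  shows "Cauchy X"
proof (rule metric_CauchyI)
  fix e :: real assume "e > 0"
  obtain \<alpha> where \<alpha>: "\<alpha> > 0" "\<And>v. \<alpha> * (norm v)\<^sup>2 \<le> a v v" using a_coerc by blast
  obtain n0 where n0: "\<forall>m\<ge>n0. \<forall>n\<ge>n0. a (X m - X n) (X m - X n) < \<alpha> * e\<^sup>2"
    using assms[of "\<alpha> * e\<^sup>2"] \<alpha> \<open>e > 0\<close> by auto
  have "dist (X m) (X n) < e" if "m \<ge> n0" "n \<ge> n0" for m n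
  proof -
    have "\<alpha> * (norm (X m - X n))\<^sup>2 < \<alpha> * e\<^sup>2" using n0 that \<alpha>(2) by (meson le_less_trans)
    then have "(norm (X m - X n))\<^sup>2 < e\<^sup>2" using \<alpha> by simp
    then show ?thesis using \<open>e > 0\<close> by (simp add: dist_norm power_less_imp_less_base)
  qed
  then show "\<exists>M. \<forall>m\<ge>M. \<forall>n\<ge>M. dist (X m) (X n) < e" by blast
qed

text \<open>Riesz representation in the energy inner product: \<open>w\<close> is the limit of a
  minimizing sequence of \<open>a v v - 2 (h, v)\<close>.\<close>

lemma ex_riesz: "\<exists>w. \<forall>v. a w v = h \<bullet> \<iota> v"
proof -
  obtain \<alpha> where \<alpha>: "\<alpha> > 0" "\<And>v. \<alpha> * (norm v)\<^sup>2 \<le> a v v" using a_coerc by blast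
  obtain C where C: "\<And>v. norm (\<iota> v) \<le> norm v * C" using emb.bounded by blast
  \<comment> \<open>Young's inequality weighted by the coercivity constant provides the lower bound
    required for the minimization.\<close>
  have bd: "2 * (h \<bullet> \<iota> v) \<le> (norm h * C)\<^sup>2 / \<alpha> + a v v" for v
  proof -
    have "h \<bullet> \<iota> v \<le> norm h * norm (\<iota> v)" by (rule norm_cauchy_schwarz)
    also have "\<dots> \<le> norm h * (norm v * C)" by (intro mult_left_mono C) auto
    finally have "2 * (h \<bullet> \<iota> v) \<le> 2 * (norm h * C) * norm v" by (simp add: mult_ac)
    also have "\<dots> \<le> (norm h * C)\<^sup>2 / \<alpha> + \<alpha> * (norm v)\<^sup>2"
    proof -
      have "0 \<le> (norm h * C - \<alpha> * norm v)\<^sup>2 / \<alpha>" using \<alpha> by simp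
      also have "\<dots> = (norm h * C)\<^sup>2 / \<alpha> + \<alpha> * (norm v)\<^sup>2 - 2 * (norm h * C) * norm v"
        using \<alpha>(1) by (simp add: field_simps power2_eq_square)
      finally show ?thesis by simp
    qed
    finally show ?thesis using \<alpha>(2)[of v] by linarith
  qed
  have "\<exists>X. (\<forall>n. X n \<in> UNIV)
      \<and> (\<forall>e>0. \<exists>n0. \<forall>m\<ge>n0. \<forall>n\<ge>n0. a (X m + (-1) *\<^sub>R X n) (X m + (-1) *\<^sub>R X n) < e)
      \<and> (\<forall>v\<in>UNIV. (\<lambda>n. a (X n) v) \<longlonglongrightarrow> h \<bullet> \<iota> v)"
    by (rule minimizing_sequence[where M = "(norm h * C)\<^sup>2 / \<alpha>"],
        simp_all add: emb.add emb.scaleR inner_add_right a.add_left a.scaleR_left a_nonneg bd)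
       (rule a_sym)
  then obtain X where X: "\<And>e. e > 0 \<Longrightarrow> \<exists>n0. \<forall>m\<ge>n0. \<forall>n\<ge>n0. a (X m + (-1) *\<^sub>R X n) (X m + (-1) *\<^sub>R X n) < e"
    "\<And>v. (\<lambda>n. a (X n) v) \<longlonglongrightarrow> h \<bullet> \<iota> v"
    by auto
  have "Cauchy X" by (rule a_Cauchy) (use X(1) in simp)
  then obtain w where w: "X \<longlonglongrightarrow> w" by (auto simp: Cauchy_convergent_iff convergent_def)
  have "a w v = h \<bullet> \<iota> v" for v
    by (rule LIMSEQ_unique[OF a.tendsto[OF w tendsto_const] X(2)])
  then show ?thesis by blast
qed

text \<open>\<open>riesz u\<close> is \<open>A\<^sup>-\<^sup>1 (\<iota> u)\<close>.\<close>
definition riesz :: "'v \<Rightarrow> 'v" where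
  "riesz u = (SOME w. \<forall>v. a w v = \<iota> u \<bullet> \<iota> v)"

lemma a_riesz: "a (riesz u) v = \<iota> u \<bullet> \<iota> v"
  unfolding riesz_def using someI_ex[OF ex_riesz[of "\<iota> u"]] by blast

lemma a_riesz': "a v (riesz u) = \<iota> u \<bullet> \<iota> v"
  using a_riesz a_sym by simp

lemma a_eqI: "u = w" if "\<And>v. a u v = a w v"
proof -
  have "a (u - w) (u - w) = 0" using that by (simp add: a.diff_left)
  then show ?thesis using a_definite by force
qed

text \<open>Linearity comes from uniqueness of the representing vector, the bound from testing with
  \<open>riesz u\<close> itself. Boundedness makes the inner product of the dual space a bounded
  bilinear form (\<open>riesz_bilinear\<close>).\<close>

lemma riesz_bounded_linear: "bounded_linear riesz"
proof -
  obtain \<alpha> where \<alpha>: "\<alpha> > 0" "\<And>v. \<alpha> * (norm v)\<^sup>2 \<le> a v v" using a_coerc by blast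
  obtain C where C: "\<And>u v. norm (\<iota> u \<bullet> \<iota> v) \<le> norm u * norm v * C"
    using bounded_bilinear.bounded[OF emb_bilinear] by blast
  have "norm (riesz u) \<le> norm u * (C / \<alpha>)" for u
  proof (cases "riesz u = 0")
    case True
    \<comment> \<open>The constant \<open>C\<close> comes without a sign; its estimate at the pair
      \<open>u\<close>, \<open>u\<close> shows that \<open>norm u * C\<close> is
      nonnegative.\<close>
    have "0 \<le> norm u * (norm u * C)" using C[of u u] by (metis mult.assoc norm_ge_zero order_trans)
    then have "0 \<le> norm u * C" by (cases "u = 0") (simp_all add: zero_le_mult_iff)
    then show ?thesis using True \<alpha> by simp
  next
    case False
    have "\<alpha> * (norm (riesz u))\<^sup>2 \<le> norm u * norm (riesz u) * C"
      using \<alpha>(2)[of "riesz u"] C[of u "riesz u"] by (simp add: a_riesz)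
    then have "norm (riesz u) * (norm (riesz u) * \<alpha>) \<le> norm (riesz u) * (norm u * C)"
      by (simp add: power2_eq_square mult_ac)
    then have "norm (riesz u) * \<alpha> \<le> norm u * C" using False by simp
    then show ?thesis using \<alpha>(1) by (simp add: field_simps)
  qed
  then show ?thesis
    by (intro bounded_linear_intro[of _ "C / \<alpha>"] a_eqI)
       (simp_all add: a_riesz a.add_left a.scaleR_left emb.add emb.scaleR inner_add_left)
qed

sublocale riesz: bounded_linear riesz by (rule riesz_bounded_linear)

text \<open>Cauchy-Schwarz for \<open>a\<close> bounds the quotients, and \<open>w = riesz u\<close>
  attains the bound. So the squared dual norm is a quadratic form, which can be integrated and
  expanded in coordinates.\<close>

lemma dual_norm_sq: "(dual_norm \<iota> a (\<iota> u))\<^sup>2 = a (riesz u) (riesz u)"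
proof -
  define R where "R = sqrt (a (riesz u) (riesz u))"
  have le: "(\<iota> u \<bullet> \<iota> w) / sqrt (a w w) \<le> R" for w
  proof (cases "w = 0")
    case True
    then show ?thesis by (simp add: emb.zero R_def a_nonneg)
  next
    case False
    define s where "s = sqrt (a w w)"
    have s: "s > 0" "s * s = a w w" using a_pos[OF False] by (auto simp: s_def)
    have RR: "R * R = a (riesz u) (riesz u)" "R \<ge> 0" by (auto simp: R_def a_nonneg)
    have "(a (riesz u) w)\<^sup>2 \<le> a (riesz u) (riesz u) * a w w"
    proof -
      \<comment> \<open>The coefficient of the energy projection of \<open>riesz u\<close> onto
        \<open>w\<close>.\<close>
      define t where "t = a (riesz u) w / a w w"
      have "0 \<le> a (riesz u - t *\<^sub>R w) (riesz u - t *\<^sub>R w)" by (rule a_nonneg)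
      also have "\<dots> = a (riesz u) (riesz u) - (a (riesz u) w)\<^sup>2 / a w w"
        using a_pos[OF False]
        by (simp add: a.diff_left a.diff_right a.scaleR_left a.scaleR_right a_sym[of w "riesz u"] t_def power2_eq_square)
      finally show ?thesis using a_pos[OF False] by (simp add: field_simps)
    qed
    also have "\<dots> = (R * s)\<^sup>2" by (simp add: power2_eq_square RR(1)[symmetric] s(2)[symmetric] mult_ac)
    finally have "a (riesz u) w \<le> R * s"
      by (rule power2_le_imp_le) (use s(1) RR(2) in simp)
    then show ?thesis unfolding s_def[symmetric] using s by (simp add: a_riesz pos_divide_le_eq)
  qed
  have "dual_norm \<iota> a (\<iota> u) = R"
    unfolding dual_norm_def
  proof (rule cSup_eq_maximum)
    have "R = (\<iota> u \<bullet> \<iota> (riesz u)) / sqrt (a (riesz u) (riesz u))"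
      unfolding a_riesz[symmetric] R_def using a_nonneg[of "riesz u"] by (simp add: real_div_sqrt)
    then show "R \<in> range (\<lambda>w. \<iota> u \<bullet> \<iota> w / sqrt (a w w))" by blast
  qed (use le in auto)
  then show ?thesis by (simp add: R_def a_nonneg)
qed

lemma riesz_bilinear: "bounded_bilinear (\<lambda>u v. a (riesz u) (riesz v))"
  using bounded_bilinear.comp[OF a_bdd riesz_bounded_linear riesz_bounded_linear] .

lemma emb_orth_eq_0: "h = 0" if "\<And>v. h \<bullet> \<iota> v = 0"
proof -
  have "closure (range \<iota>) \<subseteq> {x. h \<bullet> x = 0}"
    using that by (intro closure_minimal closed_hyperplane) auto
  then have "h \<in> {x. h \<bullet> x = 0}" unfolding emb_dense by blast
  then have "h \<bullet> h = 0" by blast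
  then show ?thesis by simp
qed

end

locale gelfand_interval = gelfand \<iota> a + interval_basis q l r p
  for \<iota> :: "'v::{real_inner,complete_space,second_countable_topology}
               \<Rightarrow> 'h::{real_inner,complete_space,second_countable_topology}"
    and a q l r p
begin

text \<open>The projection \<open>Q\<close> of \<open>P\<close> is controlled in the energy norm, so
  it is paired with \<open>f\<close> in the dual norm. The error \<open>E = P - Q\<close> is small
  only in the dual norm, which costs the energy norm of \<open>f\<close> and the factor
  \<open>k\<close>.\<close>

lemma functional_bound:
  fixes P P' f :: "real \<Rightarrow> 'v"
  assumes P: "vpoly n UNIV P" and P': "vpoly q UNIV P'"
    and d: "\<And>s S. (P has_vector_derivative P' s) (at s within S)"
    and k: "r - l \<le> k"
    and I1: "(\<lambda>s. \<iota> (f s) \<bullet> \<iota> (P s)) integrable_on {l..r}"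
    and I2: "(\<lambda>s. a (riesz (f s)) (riesz (f s))) integrable_on {l..r}"
    and I3: "(\<lambda>s. a (f s) (f s)) integrable_on {l..r}"
  shows "2 * integral {l..r} (\<lambda>s. \<iota> (f s) \<bullet> \<iota> (P s))
     \<le> integral {l..r} (\<lambda>s. a (riesz (f s)) (riesz (f s))) + k\<^sup>2 * integral {l..r} (\<lambda>s. a (f s) (f s))
       + (\<Sum>j\<le>q. a (coef p l r P j) (coef p l r P j))
       + (\<Sum>j\<le>q. a (riesz (coef p l r P' j)) (riesz (coef p l r P' j)))"
proof -
  define Q where "Q s = (\<Sum>j\<le>q. p j s *\<^sub>R coef p l r P j)" for s
  define E where "E s = P s - Q s" for s
  define e where "e = integral {l..r} (\<lambda>s. a (riesz (E s)) (riesz (E s)))"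
  have kpos: "k > 0" using lr k by linarith
  have vQ: "vpoly q UNIV Q" unfolding Q_def[abs_def] by (rule vpoly_basis_sum)
  have cQ: "continuous_on S Q" and cE: "continuous_on S E" for S
    unfolding E_def[abs_def] by (intro continuous_intros vpoly_continuous_on[OF vQ] vpoly_continuous_on[OF P])+
  have e: "((\<lambda>s. a (riesz (E s)) (riesz (E s))) has_integral e) {l..r}"
    unfolding e_def by (intro integrable_integral integrable_continuous_real
        bounded_bilinear.continuous_on[OF riesz_bilinear] cE)
  \<comment> \<open>The projection error is measured in the dual inner product, the one in which
    \<open>P'\<close> is controlled.\<close>
  have "e \<le> (r - l)\<^sup>2 * (\<Sum>j\<le>q. a (riesz (coef p l r P' j)) (riesz (coef p l r P' j)))"
    unfolding e_def E_def Q_def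
    by (rule projection_error[OF riesz_bilinear _ _ P P' d]) (auto simp: a_sym a_nonneg)
  also have "\<dots> \<le> k\<^sup>2 * (\<Sum>j\<le>q. a (riesz (coef p l r P' j)) (riesz (coef p l r P' j)))"
    using lr k by (intro mult_right_mono power_mono sum_nonneg a_nonneg) auto
  finally have ele: "1 / k\<^sup>2 * e \<le> (\<Sum>j\<le>q. a (riesz (coef p l r P' j)) (riesz (coef p l r P' j)))"
    using kpos by (simp add: field_simps)
  have QQ: "((\<lambda>s. a (Q s) (Q s)) has_integral (\<Sum>j\<le>q. a (coef p l r P j) (coef p l r P j))) {l..r}"
  proof -
    have "((\<lambda>s. a (Q s) (Q s)) has_integral (\<Sum>j\<le>q. a (coef p l r Q j) (coef p l r P j))) {l..r}"
      by (rule has_integral_bilinear_sum[OF a_bdd vpoly_mono[OF vQ order_refl subset_UNIV]]) (rule Q_def)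
    moreover have "coef p l r Q j = coef p l r P j" if "j \<le> q" for j
      by (rule coef_basis_sum[OF _ that]) (rule Q_def)
    ultimately show ?thesis by (simp cong: sum.cong_simp)
  qed
  have 1: "((\<lambda>s. 2 * (\<iota> (f s) \<bullet> \<iota> (P s))) has_integral 2 * integral {l..r} (\<lambda>s. \<iota> (f s) \<bullet> \<iota> (P s))) {l..r}"
    by (intro has_integral_mult_right integrable_integral I1)
  have 2: "((\<lambda>s. a (riesz (f s)) (riesz (f s)) + k\<^sup>2 * a (f s) (f s) + a (Q s) (Q s) + 1 / k\<^sup>2 * a (riesz (E s)) (riesz (E s)))
     has_integral integral {l..r} (\<lambda>s. a (riesz (f s)) (riesz (f s))) + k\<^sup>2 * integral {l..r} (\<lambda>s. a (f s) (f s))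
       + (\<Sum>j\<le>q. a (coef p l r P j) (coef p l r P j)) + 1 / k\<^sup>2 * e) {l..r}"
    by (intro has_integral_add has_integral_mult_right integrable_integral I2 I3 QQ e)
  have "2 * (\<iota> (f s) \<bullet> \<iota> (P s))
      \<le> a (riesz (f s)) (riesz (f s)) + k\<^sup>2 * a (f s) (f s) + a (Q s) (Q s) + 1 / k\<^sup>2 * a (riesz (E s)) (riesz (E s))" for s
  proof -
    \<comment> \<open>Splitting \<open>1 = k * (1 / k)\<close> before Young's inequality leaves
      \<open>k^2\<close> on \<open>f\<close>, while \<open>1 / k^2\<close> offsets the square of the
      step in the projection error.\<close>
    have "2 * (\<iota> (f s) \<bullet> \<iota> (P s)) = 2 * a (riesz (f s)) (Q s) + 2 * a (k *\<^sub>R f s) ((1 / k) *\<^sub>R riesz (E s))"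
      using kpos by (simp add: E_def a_riesz a_riesz' a.scaleR_left a.scaleR_right emb.diff emb.scaleR inner_diff_right inner_diff_left
          inner_commute[of "\<iota> (P s)"] inner_commute[of "\<iota> (Q s)"])
    moreover note two_a_le[of "riesz (f s)" "Q s"] two_a_le[of "k *\<^sub>R f s" "(1 / k) *\<^sub>R riesz (E s)"]
    ultimately show ?thesis by (simp add: a.scaleR_left a.scaleR_right power2_eq_square)
  qed
  from has_integral_le[OF 1 2 this] ele show ?thesis by linarith
qed

end

subsection \<open>The adjoint form on a mesh\<close>

text \<open>Domination by the integrable function \<open>1 + |f|^2\<close>. This covers both the
  quadratic terms in \<open>f\<close> and its pairing with a polynomial, and passes from the
  Lebesgue to the gauge integral.\<close>

lemma integrable_on_growth_comp:
  fixes f :: "real \<Rightarrow> 'v::{real_normed_vector,second_countable_topology}" and h :: "real \<times> 'v \<Rightarrow> real"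
  assumes f_meas: "set_borel_measurable lborel {0..T} f"
    and f_L2: "set_integrable lborel {0..T} (\<lambda>s. (norm (f s))\<^sup>2)"
    and h: "continuous_on UNIV h"
    and lr: "{l..r} \<subseteq> {0..T}"
    and bd: "\<And>s v. s \<in> {l..r} \<Longrightarrow> \<bar>h (s, v)\<bar> \<le> C * (1 + (norm v)\<^sup>2)"
  shows "(\<lambda>s. h (s, f s)) integrable_on {l..r}"
proof -
  \<comment> \<open>Measurability is known only for \<open>f\<close> cut off outside
    \<open>{0..T}\<close>, so \<open>h\<close> is composed with the cut-off, which agrees with
    \<open>f\<close> on \<open>{l..r}\<close>.\<close>
  let ?f = "\<lambda>s. indicator {0..T} s *\<^sub>R f s"
  have m: "?f \<in> borel_measurable lborel" using f_meas unfolding set_borel_measurable_def .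
  have "(\<lambda>s. (s, ?f s)) \<in> borel_measurable lborel"
    by (rule borel_measurable_Pair[OF _ m]) simp
  then have hm: "(\<lambda>s. h (s, ?f s)) \<in> borel_measurable lborel"
    by (rule borel_measurable_continuous_on[OF h])
  have "set_integrable lborel {l..r} (\<lambda>s. (norm (f s))\<^sup>2)"
    by (rule set_integrable_subset[OF f_L2]) (use lr in auto)
  moreover have "set_integrable lborel {l..r} (\<lambda>s. 1 :: real)"
    by (intro borel_integrable_atLeastAtMost' continuous_on_const)
  ultimately have 1: "set_integrable lborel {l..r} (\<lambda>s. C * (1 + (norm (f s))\<^sup>2))"
    by (intro set_integrable_mult_right set_integral_add(1))
  have "set_integrable lborel {l..r} (\<lambda>s. h (s, ?f s))"
    unfolding set_integrable_def
  proof (rule Bochner_Integration.integrable_bound[OF 1[unfolded set_integrable_def]])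
    show "(\<lambda>x. indicat_real {l..r} x *\<^sub>R h (x, ?f x)) \<in> borel_measurable lborel"
      by (intro borel_measurable_scaleR hm) simp
    show "AE x in lborel. norm (indicat_real {l..r} x *\<^sub>R h (x, ?f x))
        \<le> norm (indicat_real {l..r} x *\<^sub>R (C * (1 + (norm (f x))\<^sup>2)))"
    proof (rule AE_I2)
      fix x
      show "norm (indicat_real {l..r} x *\<^sub>R h (x, ?f x))
        \<le> norm (indicat_real {l..r} x *\<^sub>R (C * (1 + (norm (f x))\<^sup>2)))"
      proof (cases "x \<in> {l..r}")
        case True
        then have "x \<in> {0..T}" using lr by blast
        then show ?thesis using True bd[OF True, of "f x"] by simp
      qed simp
    qed
  qed
  then have "(\<lambda>s. h (s, ?f s)) integrable_on {l..r}" by (rule set_borel_integral_eq_integral(1))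
  moreover have "h (s, ?f s) = h (s, f s)" if "s \<in> {l..r}" for s
  proof -
    have "s \<in> {0..T}" using that lr by blast
    then show ?thesis by simp
  qed
  ultimately show ?thesis by (rule integrable_eq)
qed

locale gelfand_mesh = gelfand \<iota> a
  for \<iota> :: "'v::{real_inner,complete_space,second_countable_topology}
               \<Rightarrow> 'h::{real_inner,complete_space,second_countable_topology}"
    and a :: "'v \<Rightarrow> 'v \<Rightarrow> real" +
  fixes tt :: "nat \<Rightarrow> real" and N q :: nat and T :: real and p :: "nat \<Rightarrow> nat \<Rightarrow> real \<Rightarrow> real"
  assumes mesh: "mesh_ok tt N T"
    and basis: "\<And>i. i < N \<Longrightarrow> orthonormal_polys q (tt i) (tt (Suc i)) (p i)"
begin

section \<open>Mesh intervals and integrals assembled over them\<close>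

lemma tt_0: "tt 0 = 0" and tt_N: "tt N = T"
  and tt_less: "\<And>i. i < N \<Longrightarrow> tt i < tt (Suc i)"
  using mesh unfolding mesh_ok_def by auto

lemma interval: "gelfand_interval \<iota> a q (tt i) (tt (Suc i)) (p i)" if "i < N"
  by unfold_locales (use that in \<open>auto intro: tt_less basis\<close>)

lemma tt_mono: "tt i \<le> tt j" if "i \<le> j" "j \<le> N"
  using that
proof (induction j rule: dec_induct)
  case (step j)
  then show ?case using tt_less[of j] by force
qed simp

lemma subinterval: "{tt i..tt (Suc i)} \<subseteq> {0..T}" if "i < N"
  using tt_mono[of 0 i] tt_mono[of "Suc i" N] that by (auto simp: tt_0 tt_N)

lemma has_integral_mesh:
  fixes g :: "real \<Rightarrow> real"
  assumes "\<And>i. i < N \<Longrightarrow> (g has_integral c i) {tt i..tt (Suc i)}"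
  shows "(g has_integral (\<Sum>i<N. c i)) {0..T}"
proof -
  have "n \<le> N \<Longrightarrow> (g has_integral (\<Sum>i<n. c i)) {tt 0..tt n}" for n
  proof (induction n)
    case 0
    then show ?case using has_integral_refl(2)[of g "tt 0"] by simp
  next
    case (Suc n)
    then show ?case
      using has_integral_combine[of "tt 0" "tt n" "tt (Suc n)" g "\<Sum>i<n. c i" "c n"]
        tt_mono[of 0 n] tt_less[of n] assms[of n] by simp
  qed
  from this[of N] show ?thesis by (simp add: tt_0 tt_N)
qed

abbreviation coefs :: "(real \<Rightarrow> 'v) \<Rightarrow> nat \<Rightarrow> nat \<Rightarrow> 'v" where
  "coefs g i \<equiv> coef (p i) (tt i) (tt (Suc i)) g"

text \<open>The coefficients of \<open>A\<^sup>-\<^sup>1 (- X' + A \<Pi> X)\<close>, where \<open>\<Pi>\<close> is the \<open>L\<^sup>2\<close> projection in time onto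
  polynomials of degree at most \<open>q\<close>.\<close>
definition adj :: "(real \<Rightarrow> 'v) \<Rightarrow> nat \<Rightarrow> nat \<Rightarrow> 'v" where
  "adj X i j = coefs X i j - riesz (coefs (\<lambda>s. vector_derivative X (at s)) i j)"

text \<open>The inner product of \<open>S X\<close> and \<open>S Z\<close> in the space of the norm
  \<open>|.|_{Y_H}\<close>, written in coordinates, where \<open>S X\<close> is the pair formed by
  \<open>adj X\<close> and the end value \<open>X(T)\<close>.\<close>

definition form :: "(real \<Rightarrow> 'v) \<Rightarrow> (real \<Rightarrow> 'v) \<Rightarrow> real" where
  "form X Z = (\<Sum>i<N. \<Sum>j\<le>q. a (adj X i j) (adj Z i j)) + \<iota> (X T) \<bullet> \<iota> (Z T)"

section \<open>The discrete spaces and their polynomial pieces\<close>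

lemma X_space_vpoly: "X_space tt N q X \<longleftrightarrow> (\<forall>i<N. vpoly (Suc q) {tt i..tt (Suc i)} X)"
  unfolding X_space_def vpoly_def ..

lemma Y_space_vpoly: "Y_space tt N q Y \<longleftrightarrow> (\<forall>i<N. vpoly q {tt i<..<tt (Suc i)} Y)"
  unfolding Y_space_def vpoly_def ..

lemma X_space_combine: "X_space tt N q (\<lambda>s. X s + c *\<^sub>R Z s)" if "X_space tt N q X" "X_space tt N q Z"
  using that vpoly_combine unfolding X_space_vpoly by blast

lemma Y_space_combine: "Y_space tt N q (\<lambda>s. X s + c *\<^sub>R Z s)" if "Y_space tt N q X" "Y_space tt N q Z"
  using that vpoly_combine unfolding Y_space_vpoly by blast

text \<open>On each interval \<open>X\<close> may be exchanged for a global polynomial. The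
  coordinates of \<open>X\<close> and of its derivative survive this since integrals ignore the
  nodes, where \<open>vector_derivative X (at s)\<close> need not be the derivative of the
  piece.\<close>

lemma X_space_piece:
  assumes X: "X_space tt N q X" and i: "i < N"
  obtains P P' where "vpoly (Suc q) UNIV P" "vpoly q UNIV P'"
    "\<And>s S. (P has_vector_derivative P' s) (at s within S)"
    "\<And>s. s \<in> {tt i..tt (Suc i)} \<Longrightarrow> X s = P s"
    "\<And>s. s \<in> {tt i<..<tt (Suc i)} \<Longrightarrow> (X has_vector_derivative P' s) (at s)"
    "\<And>j. coefs X i j = coefs P i j"
    "\<And>j. coefs (\<lambda>s. vector_derivative X (at s)) i j = coefs P' i j"
proof -
  obtain P where P: "vpoly (Suc q) UNIV P" "\<And>s. s \<in> {tt i..tt (Suc i)} \<Longrightarrow> X s = P s"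
    using X i vpoly_extend unfolding X_space_vpoly by metis
  obtain P' where P': "vpoly q UNIV P'" "\<And>s S. (P has_vector_derivative P' s) (at s within S)"
    using vpoly_deriv[OF P(1)] by blast
  have d: "(X has_vector_derivative P' s) (at s)" if "s \<in> {tt i<..<tt (Suc i)}" for s
    by (rule has_vector_derivative_transform_within_open[OF P'(2) _ that]) (use P(2) in auto)
  show thesis
    by (rule that[OF P(1) P'(1) P'(2) P(2) d])
       (auto intro!: coef_cong simp: P(2) vector_derivative_at[OF d])
qed

lemma coefs_combine:
  assumes "i < N" "j \<le> q" "vpoly m {tt i<..<tt (Suc i)} g" "vpoly n {tt i<..<tt (Suc i)} h"
  shows "coefs (\<lambda>s. g s + t *\<^sub>R h s) i j = coefs g i j + t *\<^sub>R coefs h i j"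
proof -
  interpret gelfand_interval \<iota> a q "tt i" "tt (Suc i)" "p i" by (rule interval[OF assms(1)])
  show ?thesis by (rule coef_combine[OF assms(3,4,2)])
qed

text \<open>At a node \<open>vector_derivative\<close> need not be additive, so linearity is derived
  from the polynomial pieces on the open interval.\<close>

lemma adj_combine:
  assumes "X_space tt N q X" "X_space tt N q Z" "i < N" "j \<le> q"
  shows "adj (\<lambda>s. X s + c *\<^sub>R Z s) i j = adj X i j + c *\<^sub>R adj Z i j"
proof -
  obtain P P' where P: "vpoly (Suc q) UNIV P" "vpoly q UNIV P'"
    "\<And>s S. (P has_vector_derivative P' s) (at s within S)"
    "\<And>s. s \<in> {tt i..tt (Suc i)} \<Longrightarrow> X s = P s"
    "\<And>s. s \<in> {tt i<..<tt (Suc i)} \<Longrightarrow> (X has_vector_derivative P' s) (at s)"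
    "\<And>j. coefs X i j = coefs P i j"
    "\<And>j. coefs (\<lambda>s. vector_derivative X (at s)) i j = coefs P' i j"
    by (rule X_space_piece[OF assms(1,3)]) (rule that; assumption)
  obtain R R' where R: "vpoly (Suc q) UNIV R" "vpoly q UNIV R'"
    "\<And>s S. (R has_vector_derivative R' s) (at s within S)"
    "\<And>s. s \<in> {tt i..tt (Suc i)} \<Longrightarrow> Z s = R s"
    "\<And>s. s \<in> {tt i<..<tt (Suc i)} \<Longrightarrow> (Z has_vector_derivative R' s) (at s)"
    "\<And>j. coefs Z i j = coefs R i j"
    "\<And>j. coefs (\<lambda>s. vector_derivative Z (at s)) i j = coefs R' i j"
    by (rule X_space_piece[OF assms(2,3)]) (rule that; assumption)
  have 1: "coefs (\<lambda>s. X s + c *\<^sub>R Z s) i j = coefs (\<lambda>s. P s + c *\<^sub>R R s) i j"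
    by (rule coef_cong) (use P(4) R(4) in auto)
  have d: "((\<lambda>s. X s + c *\<^sub>R Z s) has_vector_derivative P' s + c *\<^sub>R R' s) (at s)"
    if "s \<in> {tt i<..<tt (Suc i)}" for s
    by (rule has_vector_derivative_add[OF P(5)[OF that]
          bounded_linear.has_vector_derivative[OF bounded_linear_scaleR_right R(5)[OF that]]])
  have 2: "coefs (\<lambda>s. vector_derivative (\<lambda>s. X s + c *\<^sub>R Z s) (at s)) i j = coefs (\<lambda>s. P' s + c *\<^sub>R R' s) i j"
    by (rule coef_cong) (use vector_derivative_at[OF d] in auto)
  have 3: "coefs (\<lambda>s. P s + c *\<^sub>R R s) i j = coefs P i j + c *\<^sub>R coefs R i j"
    by (rule coefs_combine[OF assms(3,4)]; rule vpoly_mono[OF _ order_refl subset_UNIV]) (rule P R)+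
  have 4: "coefs (\<lambda>s. P' s + c *\<^sub>R R' s) i j = coefs P' i j + c *\<^sub>R coefs R' i j"
    by (rule coefs_combine[OF assms(3,4)]; rule vpoly_mono[OF _ order_refl subset_UNIV]) (rule P R)+
  show ?thesis
    unfolding adj_def 1 2 3 4 P(6) R(6) P(7) R(7)
    by (simp add: riesz.add riesz.scaleR scaleR_diff_right)
qed

section \<open>The form on test functions and the adjoint bilinear form\<close>

lemma form_sym: "form X Z = form Z X"
  unfolding form_def by (simp add: inner_commute a_sym)

lemma form_combine:
  assumes "X_space tt N q X" "X_space tt N q Z"
  shows "form (\<lambda>s. X s + c *\<^sub>R Z s) W = form X W + c * form Z W"
  unfolding form_def
  by (simp add: adj_combine[OF assms] a.add_left a.scaleR_left sum.distrib sum_distrib_left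
      emb.add emb.scaleR inner_add_left distrib_left)

lemma a_adj_le_form: "a (adj X i j) (adj X i j) \<le> form X X" if "i < N" "j \<le> q"
proof -
  have "a (adj X i j) (adj X i j) \<le> (\<Sum>j\<le>q. a (adj X i j) (adj X i j))"
    using that by (intro member_le_sum[of j _ "\<lambda>j. a (adj X i j) (adj X i j)"]) (auto simp: a_nonneg)
  also have "\<dots> \<le> (\<Sum>i<N. \<Sum>j\<le>q. a (adj X i j) (adj X i j))"
    using that by (intro member_le_sum[of i _ "\<lambda>i. \<Sum>j\<le>q. a (adj X i j) (adj X i j)"]) (auto intro!: sum_nonneg simp: a_nonneg)
  also have "\<dots> \<le> form X X" unfolding form_def by simp
  finally show ?thesis .
qed

lemma end_le_form: "(norm (\<iota> (X T)))\<^sup>2 \<le> form X X"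
  unfolding form_def by (simp add: sum_nonneg a_nonneg power2_norm_eq_inner)

lemma form_nonneg: "0 \<le> form X X"
  using end_le_form[of X] by (meson order_trans zero_le_power2)

text \<open>Since \<open>Y1\<close> has degree at most \<open>q\<close>, only the coordinates of
  \<open>X\<close> and \<open>X'\<close> up to index \<open>q\<close> enter, and
  \<open>riesz\<close> rewrites the pairing with \<open>X'\<close> in terms of \<open>a\<close>.
  Hence the adjoint form is the inner product of \<open>(Y1, Y2)\<close> with
  \<open>S X\<close>.\<close>

lemma Bstar_eq:
  assumes Y: "Y_space tt N q Y1" and X: "X_space tt N q X"
  shows "Bstar \<iota> a T Y1 Y2 X = (\<Sum>i<N. \<Sum>j\<le>q. a (coefs Y1 i j) (adj X i j)) + Y2 \<bullet> \<iota> (X T)"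
proof -
  have "((\<lambda>s. - (\<iota> (Y1 s) \<bullet> \<iota> (vector_derivative X (at s))) + a (X s) (Y1 s)) has_integral
      (\<Sum>j\<le>q. a (coefs Y1 i j) (adj X i j))) {tt i..tt (Suc i)}" if i: "i < N" for i
  proof -
    interpret gelfand_interval \<iota> a q "tt i" "tt (Suc i)" "p i" by (rule interval[OF i])
    obtain P P' where P: "vpoly (Suc q) UNIV P" "vpoly q UNIV P'"
      "\<And>s S. (P has_vector_derivative P' s) (at s within S)"
      "\<And>s. s \<in> {tt i..tt (Suc i)} \<Longrightarrow> X s = P s"
      "\<And>s. s \<in> {tt i<..<tt (Suc i)} \<Longrightarrow> (X has_vector_derivative P' s) (at s)"
      "\<And>j. coefs X i j = coefs P i j"
      "\<And>j. coefs (\<lambda>s. vector_derivative X (at s)) i j = coefs P' i j"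
      by (rule X_space_piece[OF X i]) (rule that; assumption)
    have yv: "vpoly q {tt i<..<tt (Suc i)} Y1" using Y i unfolding Y_space_vpoly by blast
    note y = coef_expand[OF yv]
    have 1: "((\<lambda>s. \<iota> (P' s) \<bullet> \<iota> (Y1 s)) has_integral (\<Sum>j\<le>q. \<iota> (coefs P' i j) \<bullet> \<iota> (coefs Y1 i j)))
        {tt i..tt (Suc i)}"
      by (rule has_integral_bilinear_sum[OF emb_bilinear vpoly_mono[OF P(2) order_refl subset_UNIV] y])
    have 2: "((\<lambda>s. a (P s) (Y1 s)) has_integral (\<Sum>j\<le>q. a (coefs P i j) (coefs Y1 i j)))
        {tt i..tt (Suc i)}"
      by (rule has_integral_bilinear_sum[OF a_bdd vpoly_mono[OF P(1) order_refl subset_UNIV] y])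
    have "- (\<Sum>j\<le>q. \<iota> (coefs P' i j) \<bullet> \<iota> (coefs Y1 i j)) + (\<Sum>j\<le>q. a (coefs P i j) (coefs Y1 i j))
        = (\<Sum>j\<le>q. a (coefs Y1 i j) (adj X i j))"
      unfolding sum_negf[symmetric] sum.distrib[symmetric] adj_def P(6) P(7)
      by (intro sum.cong refl) (simp add: a.diff_right a_riesz' a_sym[of "coefs P i _"])
    with has_integral_add[OF has_integral_neg[OF 1] 2]
    have "((\<lambda>s. - (\<iota> (P' s) \<bullet> \<iota> (Y1 s)) + a (P s) (Y1 s)) has_integral
      (\<Sum>j\<le>q. a (coefs Y1 i j) (adj X i j))) {tt i..tt (Suc i)}" by simp
    then show ?thesis
      by (rule has_integral_interior_cong)
         (use P(4) in \<open>auto simp: vector_derivative_at[OF P(5)] inner_commute\<close>)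
  qed
  from has_integral_mesh[OF this] show ?thesis
    unfolding Bstar_def by (simp add: integral_unique)
qed

text \<open>In the mixed terms \<open>riesz\<close> cancels against \<open>a\<close>, leaving the
  integral of \<open>-2 (X', X)\<close>. It telescopes over the mesh and trades the end value for
  the initial value.\<close>

lemma form_self:
  assumes X: "X_space tt N q X"
  shows "form X X = (\<Sum>i<N. \<Sum>j\<le>q. a (coefs X i j) (coefs X i j))
     + (\<Sum>i<N. \<Sum>j\<le>q. a (riesz (coefs (\<lambda>s. vector_derivative X (at s)) i j))
                        (riesz (coefs (\<lambda>s. vector_derivative X (at s)) i j)))
     + (norm (\<iota> (X 0)))\<^sup>2"
proof -
  let ?D = "coefs (\<lambda>s. vector_derivative X (at s))"
  have "(\<Sum>j\<le>q. a (adj X i j) (adj X i j)) = (\<Sum>j\<le>q. a (coefs X i j) (coefs X i j))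
      + (\<Sum>j\<le>q. a (riesz (?D i j)) (riesz (?D i j)))
      - ((norm (\<iota> (X (tt (Suc i)))))\<^sup>2 - (norm (\<iota> (X (tt i))))\<^sup>2)" if i: "i < N" for i
  proof -
    interpret gelfand_interval \<iota> a q "tt i" "tt (Suc i)" "p i" by (rule interval[OF i])
    obtain P P' where P: "vpoly (Suc q) UNIV P" "vpoly q UNIV P'"
      "\<And>s S. (P has_vector_derivative P' s) (at s within S)"
      "\<And>s. s \<in> {tt i..tt (Suc i)} \<Longrightarrow> X s = P s"
      "\<And>s. s \<in> {tt i<..<tt (Suc i)} \<Longrightarrow> (X has_vector_derivative P' s) (at s)"
      "\<And>j. coefs X i j = coefs P i j"
      "\<And>j. coefs (\<lambda>s. vector_derivative X (at s)) i j = coefs P' i j"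
      by (rule X_space_piece[OF X i]) (rule that; assumption)
    have e: "X (tt i) = P (tt i)" "X (tt (Suc i)) = P (tt (Suc i))"
      using P(4) tt_less[OF i] by auto
    have "(\<Sum>j\<le>q. \<iota> (coefs P i j) \<bullet> \<iota> (coefs P' i j))
        = (\<iota> (P (tt (Suc i))) \<bullet> \<iota> (P (tt (Suc i))) - \<iota> (P (tt i)) \<bullet> \<iota> (P (tt i))) / 2"
      by (rule sum_coef_deriv[OF emb_bilinear inner_commute P(1-3)])
    then have "2 * (\<Sum>j\<le>q. \<iota> (coefs P i j) \<bullet> \<iota> (coefs P' i j))
        = (norm (\<iota> (X (tt (Suc i)))))\<^sup>2 - (norm (\<iota> (X (tt i))))\<^sup>2"
      by (simp add: e power2_norm_eq_inner)
    moreover have "(\<Sum>j\<le>q. a (adj X i j) (adj X i j)) = (\<Sum>j\<le>q. a (coefs X i j) (coefs X i j))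
      + (\<Sum>j\<le>q. a (riesz (?D i j)) (riesz (?D i j))) - 2 * (\<Sum>j\<le>q. \<iota> (coefs P i j) \<bullet> \<iota> (coefs P' i j))"
      unfolding sum_distrib_left sum.distrib[symmetric] sum_subtractf[symmetric] adj_def P(6) P(7)
      by (intro sum.cong refl)
         (simp add: a.diff_left a.diff_right a_riesz[of _ "coefs P i _"] a_riesz'[of "coefs P i _"] inner_commute)
    ultimately show ?thesis by simp
  qed
  then have "form X X = (\<Sum>i<N. (\<Sum>j\<le>q. a (coefs X i j) (coefs X i j))
      + (\<Sum>j\<le>q. a (riesz (?D i j)) (riesz (?D i j)))
      - ((norm (\<iota> (X (tt (Suc i)))))\<^sup>2 - (norm (\<iota> (X (tt i))))\<^sup>2)) + (norm (\<iota> (X T)))\<^sup>2"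
    unfolding form_def power2_norm_eq_inner by simp
  also have "\<dots> = (\<Sum>i<N. \<Sum>j\<le>q. a (coefs X i j) (coefs X i j))
      + (\<Sum>i<N. \<Sum>j\<le>q. a (riesz (?D i j)) (riesz (?D i j)))
      - ((norm (\<iota> (X (tt N))))\<^sup>2 - (norm (\<iota> (X (tt 0))))\<^sup>2) + (norm (\<iota> (X T)))\<^sup>2"
    unfolding sum_subtractf sum.distrib using sum_lessThan_telescope[of "\<lambda>i. (norm (\<iota> (X (tt i))))\<^sup>2" N, unfolded sum_subtractf]
    by simp
  finally show ?thesis by (simp add: tt_0 tt_N)
qed

subsection \<open>Uniqueness\<close>

text \<open>\<open>X(t)\<close> is the integral of \<open>Y\<close> over \<open>[t, T]\<close>, the
  test function of the uniqueness proof.\<close>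

lemma ex_backward_primitive:
  assumes Y: "Y_space tt N q Y"
  obtains X where "X_space tt N q X" "X T = 0"
    "\<And>i s. i < N \<Longrightarrow> s \<in> {tt i<..<tt (Suc i)} \<Longrightarrow> (X has_vector_derivative - Y s) (at s)"
proof -
  have "\<exists>Q. vpoly (Suc q) UNIV Q \<and> (\<forall>s\<in>{tt i<..<tt (Suc i)}. (Q has_vector_derivative Y s) (at s))"
    if "i < N" for i
  proof -
    have "vpoly q {tt i<..<tt (Suc i)} Y" using Y that unfolding Y_space_vpoly by blast
    then obtain P where P: "vpoly q UNIV P" "\<And>s. s \<in> {tt i<..<tt (Suc i)} \<Longrightarrow> Y s = P s"
      by (rule vpoly_extend) (rule that; assumption)
    obtain Q where "vpoly (Suc q) UNIV Q" "\<And>s S. (Q has_vector_derivative P s) (at s within S)"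
      using vpoly_antideriv[OF P(1)] by blast
    then show ?thesis using P(2) by auto
  qed
  then obtain Q where Q: "\<And>i. i < N \<Longrightarrow> vpoly (Suc q) UNIV (Q i)"
    "\<And>i s. i < N \<Longrightarrow> s \<in> {tt i<..<tt (Suc i)} \<Longrightarrow> (Q i has_vector_derivative Y s) (at s)"
    by metis
  \<comment> \<open>Clamping \<open>s\<close> to interval \<open>i\<close> makes each summand of
    \<open>X\<close> the integral of \<open>Y\<close> over the part of that interval beyond
    \<open>s\<close>; continuity at the nodes and \<open>X T = 0\<close> are thereby built
    in.\<close>
  define cl where "cl i s = max (tt i) (min s (tt (Suc i)))" for i s
  define X where "X s = (\<Sum>i<N. Q i (tt (Suc i)) - Q i (cl i s))" for s
  \<comment> \<open>On interval \<open>i\<close> all other summands are constant: zero for earlier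
    intervals, the full integral for later ones.\<close>
  define c where "c i = Q i (tt (Suc i)) + (\<Sum>i'\<in>{..<N} - {i}. Q i' (tt (Suc i')) - Q i' (cl i' (tt i)))" for i
  have Xi: "X s = c i + (-1) *\<^sub>R Q i s" if i: "i < N" and s: "s \<in> {tt i..tt (Suc i)}" for i s
  proof -
    have "cl i' s = cl i' (tt i)" if "i' < N" "i' \<noteq> i" for i'
    proof (cases "i' < i")
      case True
      then have "tt (Suc i') \<le> tt i" using i by (intro tt_mono) auto
      then show ?thesis using s by (simp add: cl_def)
    next
      case False
      then have "tt (Suc i) \<le> tt i'" using that by (intro tt_mono) auto
      then show ?thesis using s tt_less[OF i] unfolding cl_def
        by (metis atLeastAtMost_iff less_imp_le max.absorb1 min.coboundedI1 order_trans)
    qed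
    moreover have "cl i s = s" using s by (simp add: cl_def)
    moreover have "X s = (Q i (tt (Suc i)) - Q i (cl i s)) + (\<Sum>i'\<in>{..<N} - {i}. Q i' (tt (Suc i')) - Q i' (cl i' s))"
      unfolding X_def using i by (intro sum.remove) auto
    ultimately show ?thesis by (simp add: c_def)
  qed
  show thesis
  proof (rule that[of X])
    show "X_space tt N q X"
      unfolding X_space_vpoly
    proof (intro allI impI)
      fix i assume i: "i < N"
      have "vpoly (Suc q) {tt i..tt (Suc i)} (\<lambda>s. c i + (-1) *\<^sub>R Q i s)"
        by (intro vpoly_combine vpoly_const vpoly_mono[OF Q(1)[OF i] order_refl subset_UNIV])
      then show "vpoly (Suc q) {tt i..tt (Suc i)} X" by (rule vpoly_cong) (rule Xi[OF i])
    qed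
    have "cl i T = tt (Suc i)" if "i < N" for i
      using tt_mono[of "Suc i" N] tt_less[of i] that by (simp add: cl_def tt_N)
    then show "X T = 0" by (simp add: X_def)
    fix i s assume i: "i < N" and s: "s \<in> {tt i<..<tt (Suc i)}"
    have "((\<lambda>s. c i + (-1) *\<^sub>R Q i s) has_vector_derivative 0 + (-1) *\<^sub>R Y s) (at s)"
      by (rule has_vector_derivative_add[OF has_vector_derivative_const
            bounded_linear.has_vector_derivative[OF bounded_linear_scaleR_right Q(2)[OF i s]]])
    then have "(X has_vector_derivative 0 + (-1) *\<^sub>R Y s) (at s)"
      by (rule has_vector_derivative_transform_within_open[OF _ open_greaterThanLessThan s])
         (use Xi[OF i] in auto)
    then show "(X has_vector_derivative - Y s) (at s)" by simp
  qed
qed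

text \<open>The backward primitive of \<open>U\<close> vanishes at \<open>T\<close>, so testing with
  it removes \<open>h\<close> and forces the coordinates of \<open>U\<close> to vanish before
  \<open>h\<close> is treated.\<close>

lemma orthogonal_imp_zero:
  assumes U: "Y_space tt N q U"
    and orth: "\<And>X. X_space tt N q X \<Longrightarrow> (\<Sum>i<N. \<Sum>j\<le>q. a (coefs U i j) (adj X i j)) + h \<bullet> \<iota> (X T) = 0"
  shows "h = 0 \<and> (\<forall>i<N. \<forall>j\<le>q. coefs U i j = 0)"
proof -
  obtain X where X: "X_space tt N q X" "X T = 0"
    "\<And>i s. i < N \<Longrightarrow> s \<in> {tt i<..<tt (Suc i)} \<Longrightarrow> (X has_vector_derivative - U s) (at s)"
    by (rule ex_backward_primitive[OF U]) (rule that; assumption)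
  have "(\<Sum>j\<le>q. a (coefs U i j) (adj X i j))
      = (\<Sum>j\<le>q. (norm (\<iota> (coefs U i j)))\<^sup>2) - (a (X (tt (Suc i))) (X (tt (Suc i))) - a (X (tt i)) (X (tt i))) / 2"
    if i: "i < N" for i
  proof -
    interpret gelfand_interval \<iota> a q "tt i" "tt (Suc i)" "p i" by (rule interval[OF i])
    obtain P P' where P: "vpoly (Suc q) UNIV P" "vpoly q UNIV P'"
      "\<And>s S. (P has_vector_derivative P' s) (at s within S)"
      "\<And>s. s \<in> {tt i..tt (Suc i)} \<Longrightarrow> X s = P s"
      "\<And>s. s \<in> {tt i<..<tt (Suc i)} \<Longrightarrow> (X has_vector_derivative P' s) (at s)"
      "\<And>j. coefs X i j = coefs P i j"
      "\<And>j. coefs (\<lambda>s. vector_derivative X (at s)) i j = coefs P' i j"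
      by (rule X_space_piece[OF X(1) i]) (rule that; assumption)
    have e: "X (tt i) = P (tt i)" "X (tt (Suc i)) = P (tt (Suc i))"
      using P(4) tt_less[OF i] by auto
    have c: "coefs P' i j = - coefs U i j" for j
    proof -
      have "coefs P' i j = coefs (\<lambda>s. - U s) i j"
        by (rule coef_cong) (rule vector_derivative_unique_at[OF P(5) X(3)[OF i]])
      then show ?thesis by (simp add: coef_def)
    qed
    have "(\<Sum>j\<le>q. a (coefs P i j) (coefs P' i j)) = (a (P (tt (Suc i))) (P (tt (Suc i))) - a (P (tt i)) (P (tt i))) / 2"
      by (rule sum_coef_deriv[OF a_bdd a_sym P(1-3)])
    \<comment> \<open>With \<open>X' = -U\<close> the derivative term yields the squared norm of
      \<open>U\<close> in \<open>'h\<close>, and the energy term becomes an exact derivative of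
      \<open>a X X\<close>.\<close>
    moreover have "(\<Sum>j\<le>q. a (coefs U i j) (adj X i j))
        = (\<Sum>j\<le>q. (norm (\<iota> (coefs U i j)))\<^sup>2) - (\<Sum>j\<le>q. a (coefs P i j) (coefs P' i j))"
      unfolding sum_subtractf[symmetric] adj_def P(6) P(7) c
      by (intro sum.cong refl)
         (simp add: linear_neg[OF bounded_linear.linear[OF riesz_bounded_linear]] a.minus_right a.add_right a_riesz' power2_norm_eq_inner a_sym[of "coefs U i _" "coefs P i _"])
    ultimately show ?thesis by (simp add: e)
  qed
  then have "(\<Sum>i<N. \<Sum>j\<le>q. a (coefs U i j) (adj X i j))
      = (\<Sum>i<N. \<Sum>j\<le>q. (norm (\<iota> (coefs U i j)))\<^sup>2)
        - (\<Sum>i<N. a (X (tt (Suc i))) (X (tt (Suc i))) - a (X (tt i)) (X (tt i))) / 2"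
    by (simp add: sum_subtractf sum_divide_distrib[symmetric])
  also have "\<dots> = (\<Sum>i<N. \<Sum>j\<le>q. (norm (\<iota> (coefs U i j)))\<^sup>2) + a (X 0) (X 0) / 2"
    unfolding sum_lessThan_telescope[of "\<lambda>i. a (X (tt i)) (X (tt i))"]
    by (simp add: tt_0 tt_N X(2) a.zero_left)
  finally have "(\<Sum>i<N. \<Sum>j\<le>q. (norm (\<iota> (coefs U i j)))\<^sup>2) + a (X 0) (X 0) / 2 = 0"
    using orth[OF X(1)] by (simp add: X(2) emb.zero)
  moreover have nn: "0 \<le> (\<Sum>i<N. \<Sum>j\<le>q. (norm (\<iota> (coefs U i j)))\<^sup>2)" by (intro sum_nonneg) auto
  ultimately have z: "(\<Sum>i<N. \<Sum>j\<le>q. (norm (\<iota> (coefs U i j)))\<^sup>2) = 0"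
    using a_nonneg[of "X 0"] by linarith
  have U0: "coefs U i j = 0" if "i < N" "j \<le> q" for i j
  proof -
    have "(\<Sum>j\<le>q. (norm (\<iota> (coefs U i j)))\<^sup>2) = 0"
      by (intro sum_nonneg_0[OF finite_lessThan _ z]) (use that in \<open>auto intro: sum_nonneg\<close>)
    then have "(norm (\<iota> (coefs U i j)))\<^sup>2 = 0"
      using sum_nonneg_0[of "{..q}" "\<lambda>j. (norm (\<iota> (coefs U i j)))\<^sup>2" j] that by auto
    then show ?thesis using emb_eq_0 by simp
  qed
  \<comment> \<open>With the coordinates of \<open>U\<close> gone, the constant test function
    \<open>v\<close> isolates \<open>h\<close>; density of the range of \<open>\<iota>\<close> then
    applies.\<close>
  have "h \<bullet> \<iota> v = 0" for v
  proof -
    have "X_space tt N q (\<lambda>_. v)" unfolding X_space_vpoly by (simp add: vpoly_const)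
    from orth[OF this] show ?thesis using U0 by (simp add: a.zero_left)
  qed
  then show ?thesis using emb_orth_eq_0 U0 by blast
qed

lemma solution_unique:
  assumes Y: "Y_space tt N q Y1" and Z: "Y_space tt N q Z1"
    and eq: "\<And>X. X_space tt N q X \<Longrightarrow> Bstar \<iota> a T Y1 Y2 X = Bstar \<iota> a T Z1 Z2 X"
  shows "Y2 = Z2 \<and> (\<forall>i<N. \<forall>s\<in>{tt i<..<tt (Suc i)}. Y1 s = Z1 s)"
proof -
  define U where "U s = Y1 s + (-1) *\<^sub>R Z1 s" for s
  have U: "Y_space tt N q U" unfolding U_def[abs_def] by (rule Y_space_combine[OF Y Z])
  have cU: "coefs U i j = coefs Y1 i j - coefs Z1 i j" if "i < N" "j \<le> q" for i j
    using coefs_combine[OF that, of q Y1 q Z1 "-1"] Y Z that unfolding Y_space_vpoly U_def[abs_def] by simp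
  have 0: "(Y2 - Z2) = 0 \<and> (\<forall>i<N. \<forall>j\<le>q. coefs U i j = 0)"
  proof (rule orthogonal_imp_zero[OF U])
    fix X :: "real \<Rightarrow> 'v" assume X: "X_space tt N q X"
    show "(\<Sum>i<N. \<Sum>j\<le>q. a (coefs U i j) (adj X i j)) + (Y2 - Z2) \<bullet> \<iota> (X T) = 0"
      using eq[OF X] unfolding Bstar_eq[OF Y X] Bstar_eq[OF Z X]
      by (simp add: cU a.diff_left sum_subtractf inner_diff_left)
  qed
  have "Y1 s = Z1 s" if i: "i < N" and s: "s \<in> {tt i<..<tt (Suc i)}" for i s
  proof -
    interpret gelfand_interval \<iota> a q "tt i" "tt (Suc i)" "p i" by (rule interval[OF i])
    have "U s = 0"
      using coef_expand[OF _ s, of U] U i 0 unfolding Y_space_vpoly by simp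
    then show ?thesis by (simp add: U_def)
  qed
  then show ?thesis using 0 by auto
qed

subsection \<open>Existence\<close>

context
  fixes f :: "real \<Rightarrow> 'v" and u0 :: 'h
  assumes f_meas: "set_borel_measurable lborel {0..T} f"
    and f_L2: "set_integrable lborel {0..T} (\<lambda>s. (norm (f s))\<^sup>2)"
begin

section \<open>Integrability of the data and the load functional\<close>

lemma integrable_bilinear_f:
  fixes b :: "'v \<Rightarrow> 'v \<Rightarrow> real"
  assumes "bounded_bilinear b" shows "(\<lambda>s. b (f s) (f s)) integrable_on {0..T}"
proof -
  interpret b: bounded_bilinear b by (rule assms)
  obtain C where C: "0 < C" "\<And>u v. norm (b u v) \<le> norm u * norm v * C" using b.pos_bounded by blast
  have "(\<lambda>s. (\<lambda>z. b (snd z) (snd z)) (s, f s)) integrable_on {0..T}"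
  proof (rule integrable_on_growth_comp[OF f_meas f_L2])
    show "continuous_on UNIV (\<lambda>z::real \<times> 'v. b (snd z) (snd z))"
      by (intro b.continuous_on continuous_intros)
    show "\<bar>b (snd (s, v)) (snd (s, v))\<bar> \<le> C * (1 + (norm v)\<^sup>2)" for s :: real and v
      using C(2)[of v v] C(1) by (simp add: power2_eq_square algebra_simps)
  qed simp
  then show ?thesis by simp
qed

lemma integrable_f_vpoly:
  assumes P: "vpoly n UNIV P" and i: "i < N"
  shows "(\<lambda>s. \<iota> (f s) \<bullet> \<iota> (P s)) integrable_on {tt i..tt (Suc i)}"
proof -
  obtain C where C: "0 < C" "\<And>u v. norm (\<iota> u \<bullet> \<iota> v) \<le> norm u * norm v * C"
    using bounded_bilinear.pos_bounded[OF emb_bilinear] by blast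
  have cP: "continuous_on S P" for S by (rule vpoly_continuous_on[OF P])
  have "bounded (P ` {tt i..tt (Suc i)})"
    by (intro compact_imp_bounded compact_continuous_image cP compact_Icc)
  then obtain D where D: "\<And>s. s \<in> {tt i..tt (Suc i)} \<Longrightarrow> norm (P s) \<le> D"
    unfolding bounded_iff by blast
  have "(\<lambda>s. (\<lambda>z. \<iota> (snd z) \<bullet> \<iota> (P (fst z))) (s, f s)) integrable_on {tt i..tt (Suc i)}"
  proof (rule integrable_on_growth_comp[OF f_meas f_L2 _ subinterval[OF i]])
    show "continuous_on UNIV (\<lambda>z::real \<times> 'v. \<iota> (snd z) \<bullet> \<iota> (P (fst z)))"
      by (intro continuous_intros emb.continuous_on continuous_on_compose2[OF cP]) auto
    fix s :: real and v :: 'v assume s: "s \<in> {tt i..tt (Suc i)}"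
    \<comment> \<open>The pairing is linear in \<open>f\<close>; this fits it into the quadratic
      growth bound.\<close>
    have "norm v \<le> 1 + (norm v)\<^sup>2"
    proof -
      have "0 \<le> (norm v - 1)\<^sup>2" by simp
      then have "2 * norm v \<le> (norm v)\<^sup>2 + 1" by (simp add: power2_diff)
      then show ?thesis using norm_ge_zero[of v] by linarith
    qed
    moreover have "0 \<le> D" using D[OF s] norm_ge_zero order_trans by blast
    ultimately have "norm v * norm (P s) \<le> (1 + (norm v)\<^sup>2) * D"
      by (intro mult_mono D s) auto
    then have "norm v * norm (P s) * C \<le> (1 + (norm v)\<^sup>2) * D * C"
      using C(1) by (intro mult_right_mono) auto
    then show "\<bar>\<iota> (snd (s, v)) \<bullet> \<iota> (P (fst (s, v)))\<bar> \<le> D * C * (1 + (norm v)\<^sup>2)"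
      using C(2)[of v "P s"] by (simp add: mult_ac)
  qed
  then show ?thesis by simp
qed

lemma integrable_f_X:
  assumes X: "X_space tt N q X" and i: "i < N"
  shows "(\<lambda>s. \<iota> (f s) \<bullet> \<iota> (X s)) integrable_on {tt i..tt (Suc i)}"
proof -
  obtain P where P: "vpoly (Suc q) UNIV P" "\<And>s. s \<in> {tt i..tt (Suc i)} \<Longrightarrow> X s = P s"
    using X i vpoly_extend unfolding X_space_vpoly by metis
  show ?thesis by (rule integrable_eq[OF integrable_f_vpoly[OF P(1) i]]) (simp add: P(2))
qed

lemma Fform_eq:
  assumes X: "X_space tt N q X"
  shows "Fform \<iota> T f u0 X
    = (\<Sum>i<N. integral {tt i..tt (Suc i)} (\<lambda>s. \<iota> (f s) \<bullet> \<iota> (X s))) + u0 \<bullet> \<iota> (X 0)"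
  unfolding Fform_def
  using has_integral_mesh[OF integrable_integral[OF integrable_f_X[OF X]]] by (simp add: integral_unique)

lemma Fform_combine:
  assumes X: "X_space tt N q X" and Z: "X_space tt N q Z"
  shows "Fform \<iota> T f u0 (\<lambda>s. X s + c *\<^sub>R Z s) = Fform \<iota> T f u0 X + c * Fform \<iota> T f u0 Z"
proof -
  have "integral {tt i..tt (Suc i)} (\<lambda>s. \<iota> (f s) \<bullet> \<iota> (X s + c *\<^sub>R Z s))
      = integral {tt i..tt (Suc i)} (\<lambda>s. \<iota> (f s) \<bullet> \<iota> (X s))
        + c * integral {tt i..tt (Suc i)} (\<lambda>s. \<iota> (f s) \<bullet> \<iota> (Z s))" if i: "i < N" for i
  proof -
    have "((\<lambda>s. \<iota> (f s) \<bullet> \<iota> (X s) + c * (\<iota> (f s) \<bullet> \<iota> (Z s))) has_integral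
        integral {tt i..tt (Suc i)} (\<lambda>s. \<iota> (f s) \<bullet> \<iota> (X s))
        + c * integral {tt i..tt (Suc i)} (\<lambda>s. \<iota> (f s) \<bullet> \<iota> (Z s))) {tt i..tt (Suc i)}"
      by (intro has_integral_add has_integral_mult_right integrable_integral integrable_f_X X Z i)
    then show ?thesis
      by (simp add: emb.add emb.scaleR inner_add_right integral_unique)
  qed
  then show ?thesis
    unfolding Fform_eq[OF X_space_combine[OF X Z]] Fform_eq[OF X] Fform_eq[OF Z]
    by (simp add: sum.distrib sum_distrib_left emb.add emb.scaleR inner_add_right distrib_left)
qed

text \<open>The square of the right-hand side of the stability estimate, which serves as the
  constant \<open>M\<close> of \<open>minimizing_sequence\<close>.\<close>

definition data_bound :: real where
  "data_bound = integral {0..T} (\<lambda>s. (dual_norm \<iota> a (\<iota> (f s)))\<^sup>2)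
     + (max_step tt N)\<^sup>2 * integral {0..T} (\<lambda>s. a (f s) (f s)) + (norm u0)\<^sup>2"

text \<open>Summed over the mesh, \<open>functional_bound\<close> produces exactly the terms of
  \<open>form_self\<close>, the initial value being handled by Young's inequality. The additive
  shape with unit coefficients is what yields stability with constant one.\<close>

lemma Fform_bound:
  assumes X: "X_space tt N q X"
  shows "2 * Fform \<iota> T f u0 X \<le> data_bound + form X X"
proof -
  let ?I = "\<lambda>i. integral {tt i..tt (Suc i)}"
  let ?k = "max_step tt N"
  let ?D = "coefs (\<lambda>s. vector_derivative X (at s))"
  have R: "(\<lambda>s. a (riesz (f s)) (riesz (f s))) integrable_on {0..T}"
    by (rule integrable_bilinear_f[OF riesz_bilinear])
  have S: "(\<lambda>s. a (f s) (f s)) integrable_on {0..T}"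
    by (rule integrable_bilinear_f[OF a_bdd])
  have sub: "g integrable_on {tt i..tt (Suc i)}" if "g integrable_on {0..T}" "i < N" for i and g :: "real \<Rightarrow> real"
    by (rule integrable_on_subinterval[OF that(1) subinterval[OF that(2)]])
  have spl: "integral {0..T} g = (\<Sum>i<N. ?I i g)" if "g integrable_on {0..T}" for g :: "real \<Rightarrow> real"
    by (rule integral_unique, rule has_integral_mesh, rule integrable_integral, rule sub[OF that])
  have "2 * ?I i (\<lambda>s. \<iota> (f s) \<bullet> \<iota> (X s)) \<le> ?I i (\<lambda>s. a (riesz (f s)) (riesz (f s))) + ?k\<^sup>2 * ?I i (\<lambda>s. a (f s) (f s))
      + (\<Sum>j\<le>q. a (coefs X i j) (coefs X i j)) + (\<Sum>j\<le>q. a (riesz (?D i j)) (riesz (?D i j)))"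
    if i: "i < N" for i
  proof -
    interpret gelfand_interval \<iota> a q "tt i" "tt (Suc i)" "p i" by (rule interval[OF i])
    obtain P P' where P: "vpoly (Suc q) UNIV P" "vpoly q UNIV P'"
      "\<And>s S. (P has_vector_derivative P' s) (at s within S)"
      "\<And>s. s \<in> {tt i..tt (Suc i)} \<Longrightarrow> X s = P s"
      "\<And>s. s \<in> {tt i<..<tt (Suc i)} \<Longrightarrow> (X has_vector_derivative P' s) (at s)"
      "\<And>j. coefs X i j = coefs P i j"
      "\<And>j. ?D i j = coefs P' i j"
      by (rule X_space_piece[OF X i]) (rule that; assumption)
    have k: "tt (Suc i) - tt i \<le> ?k"
      unfolding max_step_def using i by (intro Max_ge) auto
    have "?I i (\<lambda>s. \<iota> (f s) \<bullet> \<iota> (X s)) = ?I i (\<lambda>s. \<iota> (f s) \<bullet> \<iota> (P s))"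
      by (rule integral_cong) (simp add: P(4))
    then show ?thesis
      unfolding P(6) P(7)
      using functional_bound[OF P(1-3) k integrable_f_vpoly[OF P(1) i] sub[OF R i] sub[OF S i]] by simp
  qed
  from sum_mono[of "{..<N}", OF this]
  have "2 * (\<Sum>i<N. ?I i (\<lambda>s. \<iota> (f s) \<bullet> \<iota> (X s)))
      \<le> integral {0..T} (\<lambda>s. a (riesz (f s)) (riesz (f s))) + ?k\<^sup>2 * integral {0..T} (\<lambda>s. a (f s) (f s))
        + (\<Sum>i<N. \<Sum>j\<le>q. a (coefs X i j) (coefs X i j)) + (\<Sum>i<N. \<Sum>j\<le>q. a (riesz (?D i j)) (riesz (?D i j)))"
    unfolding spl[OF R] spl[OF S] by (simp add: sum.distrib sum_distrib_left)
  moreover have "2 * (u0 \<bullet> \<iota> (X 0)) \<le> (norm u0)\<^sup>2 + (norm (\<iota> (X 0)))\<^sup>2"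
    using inner_ge_zero[of "u0 - \<iota> (X 0)"]
    by (simp add: power2_norm_eq_inner inner_diff_left inner_diff_right inner_commute)
  ultimately show ?thesis
    unfolding Fform_eq[OF X] form_self[OF X] data_bound_def dual_norm_sq by simp
qed

text \<open>A minimizing sequence of test functions need not converge itself, but its images under
  \<open>S\<close> do, since \<open>form\<close> controls their coordinates and the end values.
  Their limit solves the problem.\<close>

lemma solution_exists:
  "\<exists>Y1 Y2. Y_space tt N q Y1
     \<and> (\<forall>X. X_space tt N q X \<longrightarrow> Bstar \<iota> a T Y1 Y2 X = Fform \<iota> T f u0 X)
     \<and> (norm Y2)\<^sup>2 + integral {0..T} (\<lambda>s. a (Y1 s) (Y1 s)) \<le> data_bound"
proof -
  have "\<exists>X. (\<forall>n. X n \<in> {X. X_space tt N q X})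
      \<and> (\<forall>e>0. \<exists>n0. \<forall>m\<ge>n0. \<forall>n\<ge>n0. form (\<lambda>s. X m s + (-1) *\<^sub>R X n s) (\<lambda>s. X m s + (-1) *\<^sub>R X n s) < e)
      \<and> (\<forall>x\<in>{X. X_space tt N q X}. (\<lambda>n. form (X n) x) \<longlonglongrightarrow> Fform \<iota> T f u0 x)"
  proof (rule minimizing_sequence)
    show "{X :: real \<Rightarrow> 'v. X_space tt N q X} \<noteq> {}"
      using vpoly_const[of "Suc q" _ "0::'v"] by (auto simp: X_space_vpoly)
    show "2 * Fform \<iota> T f u0 X \<le> data_bound + form X X" if "X \<in> {X. X_space tt N q X}" for X
      using that Fform_bound by simp
  qed (auto simp: X_space_combine Fform_combine form_combine form_nonneg intro: form_sym)
  then obtain X where X: "\<And>n. X_space tt N q (X n)"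
    and cau: "\<And>e. e > 0 \<Longrightarrow> \<exists>n0. \<forall>m\<ge>n0. \<forall>n\<ge>n0. form (\<lambda>s. X m s + (-1) *\<^sub>R X n s) (\<lambda>s. X m s + (-1) *\<^sub>R X n s) < e"
    and lim: "\<And>x. X_space tt N q x \<Longrightarrow> (\<lambda>n. form (X n) x) \<longlonglongrightarrow> Fform \<iota> T f u0 x"
    by auto
  have "\<exists>y. (\<lambda>n. adj (X n) i j) \<longlonglongrightarrow> y" if ij: "i < N" "j \<le> q" for i j
  proof -
    have "Cauchy (\<lambda>n. adj (X n) i j)"
    proof (rule a_Cauchy)
      fix e :: real assume "e > 0"
      then obtain n0 where n0: "\<forall>m\<ge>n0. \<forall>n\<ge>n0. form (\<lambda>s. X m s + (-1) *\<^sub>R X n s) (\<lambda>s. X m s + (-1) *\<^sub>R X n s) < e"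
        using cau by blast
      have "a (adj (X m) i j - adj (X n) i j) (adj (X m) i j - adj (X n) i j) < e" if "m \<ge> n0" "n \<ge> n0" for m n
        using a_adj_le_form[OF ij, of "\<lambda>s. X m s + (-1) *\<^sub>R X n s"] n0[rule_format, OF that]
        unfolding adj_combine[OF X X ij] by simp
      then show "\<exists>n0. \<forall>m\<ge>n0. \<forall>n\<ge>n0. a (adj (X m) i j - adj (X n) i j) (adj (X m) i j - adj (X n) i j) < e"
        by blast
    qed
    then show ?thesis by (auto simp: Cauchy_convergent_iff convergent_def)
  qed
  then obtain y where y: "\<And>i j. i < N \<Longrightarrow> j \<le> q \<Longrightarrow> (\<lambda>n. adj (X n) i j) \<longlonglongrightarrow> y i j" by metis
  have "Cauchy (\<lambda>n. \<iota> (X n T))"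
  proof (rule metric_CauchyI)
    fix e :: real assume "e > 0"
    then obtain n0 where n0: "\<forall>m\<ge>n0. \<forall>n\<ge>n0. form (\<lambda>s. X m s + (-1) *\<^sub>R X n s) (\<lambda>s. X m s + (-1) *\<^sub>R X n s) < e\<^sup>2"
      using cau[of "e\<^sup>2"] by auto
    have "dist (\<iota> (X m T)) (\<iota> (X n T)) < e" if "m \<ge> n0" "n \<ge> n0" for m n
    proof -
      have "(norm (\<iota> (X m T) - \<iota> (X n T)))\<^sup>2 < e\<^sup>2"
        using end_le_form[of "\<lambda>s. X m s + (-1) *\<^sub>R X n s"] n0[rule_format, OF that] by (simp add: emb.diff)
      then show ?thesis using \<open>e > 0\<close> by (simp add: dist_norm power_less_imp_less_base)
    qed
    then show "\<exists>M. \<forall>m\<ge>M. \<forall>n\<ge>M. dist (\<iota> (X m T)) (\<iota> (X n T)) < e" by blast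
  qed
  then obtain Y2 where Y2: "(\<lambda>n. \<iota> (X n T)) \<longlonglongrightarrow> Y2" by (auto simp: Cauchy_convergent_iff convergent_def)
  \<comment> \<open>The limit coordinates are glued on the open intervals; nodes receive the value
    zero.\<close>
  define Y1 where "Y1 s = (\<Sum>i<N. indicator {tt i<..<tt (Suc i)} s *\<^sub>R (\<Sum>j\<le>q. p i j s *\<^sub>R y i j))" for s
  have Y1i: "Y1 s = (\<Sum>j\<le>q. p i j s *\<^sub>R y i j)" if i: "i < N" and s: "s \<in> {tt i<..<tt (Suc i)}" for i s
  proof -
    have "s \<notin> {tt i'<..<tt (Suc i')}" if "i' < N" "i' \<noteq> i" for i'
    proof (cases "i' < i")
      case True
      then show ?thesis using tt_mono[of "Suc i'" i] i s by auto
    next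
      case False
      then show ?thesis using tt_mono[of "Suc i" i'] that s by auto
    qed
    then have "Y1 s = (\<Sum>i'\<in>{i}. indicator {tt i'<..<tt (Suc i')} s *\<^sub>R (\<Sum>j\<le>q. p i' j s *\<^sub>R y i' j))"
      unfolding Y1_def using i by (intro sum.mono_neutral_right) auto
    also have "\<dots> = indicator {tt i<..<tt (Suc i)} s *\<^sub>R (\<Sum>j\<le>q. p i j s *\<^sub>R y i j)" by (subst sum.insert) (simp_all del: indicator_simps)
    finally show ?thesis using s by simp
  qed
  have Y: "Y_space tt N q Y1"
    unfolding Y_space_vpoly
  proof (intro allI impI)
    fix i assume i: "i < N"
    interpret gelfand_interval \<iota> a q "tt i" "tt (Suc i)" "p i" by (rule interval[OF i])
    show "vpoly q {tt i<..<tt (Suc i)} Y1"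
      by (rule vpoly_cong[OF vpoly_basis_sum Y1i[OF i]])
  qed
  have cY: "coefs Y1 i j = y i j" if "i < N" "j \<le> q" for i j
  proof -
    interpret gelfand_interval \<iota> a q "tt i" "tt (Suc i)" "p i" by (rule interval[OF that(1)])
    show ?thesis by (rule coef_basis_sum[OF Y1i[OF that(1)] that(2)])
  qed
  \<comment> \<open>The squared norm of the pair \<open>(Y1, Y2)\<close> in coordinates.\<close>
  define n2 where "n2 = (\<Sum>i<N. \<Sum>j\<le>q. a (y i j) (y i j)) + Y2 \<bullet> Y2"
  have B: "Bstar \<iota> a T Y1 Y2 x = (\<Sum>i<N. \<Sum>j\<le>q. a (y i j) (adj x i j)) + Y2 \<bullet> \<iota> (x T)" if "X_space tt N q x" for x
    unfolding Bstar_eq[OF Y that] by (simp add: cY)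
  have sol: "Bstar \<iota> a T Y1 Y2 x = Fform \<iota> T f u0 x" if x: "X_space tt N q x" for x
  proof -
    have "(\<lambda>n. form (X n) x) \<longlonglongrightarrow> (\<Sum>i<N. \<Sum>j\<le>q. a (y i j) (adj x i j)) + Y2 \<bullet> \<iota> (x T)"
      unfolding form_def by (intro tendsto_add tendsto_sum a.tendsto y tendsto_inner Y2 tendsto_const) auto
    then show ?thesis using LIMSEQ_unique[OF _ lim[OF x]] B[OF x] by simp
  qed
  have n2: "n2 = (norm Y2)\<^sup>2 + integral {0..T} (\<lambda>s. a (Y1 s) (Y1 s))"
  proof -
    have "((\<lambda>s. a (Y1 s) (Y1 s)) has_integral (\<Sum>j\<le>q. a (y i j) (y i j))) {tt i..tt (Suc i)}" if i: "i < N" for i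
    proof -
      interpret gelfand_interval \<iota> a q "tt i" "tt (Suc i)" "p i" by (rule interval[OF i])
      have "vpoly q {tt i<..<tt (Suc i)} Y1" using Y i unfolding Y_space_vpoly by blast
      from has_integral_bilinear_sum[OF a_bdd this Y1i[OF i]] show ?thesis by (simp add: cY i)
    qed
    from has_integral_mesh[OF this] show ?thesis
      by (simp add: n2_def power2_norm_eq_inner integral_unique)
  qed
  have 1: "(\<lambda>n. form (X n) (X n)) \<longlonglongrightarrow> n2"
    unfolding form_def n2_def by (intro tendsto_add tendsto_sum a.tendsto y tendsto_inner Y2) auto
  \<comment> \<open>The solution is the limit of \<open>S (X n)\<close>, so its inner product with
    \<open>S (X n)\<close> tends to its own squared norm; \<open>Fform\<close> along the sequence
    thus has the same limit as \<open>form\<close>.\<close>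
  have "(\<lambda>n. Bstar \<iota> a T Y1 Y2 (X n)) \<longlonglongrightarrow> n2"
    unfolding B[OF X] n2_def by (intro tendsto_add tendsto_sum a.tendsto y tendsto_inner Y2 tendsto_const) auto
  then have 2: "(\<lambda>n. 2 * Fform \<iota> T f u0 (X n)) \<longlonglongrightarrow> 2 * n2"
    unfolding sol[OF X] by (intro tendsto_intros)
  \<comment> \<open>Passing to the limit in \<open>Fform_bound\<close>; one \<open>n2\<close>
    cancels and the stability estimate remains.\<close>
  have "2 * n2 \<le> data_bound + n2"
    by (rule LIMSEQ_le[OF 2 tendsto_add[OF tendsto_const 1]]) (use Fform_bound[OF X] in auto)
  then show ?thesis using Y sol n2 by (intro exI[of _ Y1] exI[of _ Y2]) auto
qed

end

end

section \<open>Existence, uniqueness and stability of the discrete solution\<close>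

theorem theorem5p4:
  fixes \<iota> :: "'v::{real_inner,complete_space,second_countable_topology}
               \<Rightarrow> 'h::{real_inner,complete_space,second_countable_topology}"
    and a :: "'v \<Rightarrow> 'v \<Rightarrow> real"
    and tt :: "nat \<Rightarrow> real" and N q :: nat and T :: real
    and f :: "real \<Rightarrow> 'v" and u0 :: 'h
  assumes emb_lin: "bounded_linear \<iota>" and emb_inj: "inj \<iota>"
    and emb_dense: "closure (range \<iota>) = UNIV"
    and a_bdd: "bounded_bilinear a" and a_sym: "\<forall>u v. a u v = a v u"
    and a_coerc: "\<exists>\<alpha>>0. \<forall>v. \<alpha> * (norm v)\<^sup>2 \<le> a v v"
    and mesh: "mesh_ok tt N T"
    and f_meas: "set_borel_measurable lborel {0..T} f"
    and f_L2: "set_integrable lborel {0..T} (\<lambda>s. (norm (f s))\<^sup>2)"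
  shows "(\<exists>Y1 Y2. Y_space tt N q Y1
            \<and> (\<forall>X. X_space tt N q X \<longrightarrow> Bstar \<iota> a T Y1 Y2 X = Fform \<iota> T f u0 X)
            \<and> sqrt ((norm Y2)\<^sup>2 + integral {0..T} (\<lambda>s. a (Y1 s) (Y1 s)))
              \<le> sqrt (integral {0..T} (\<lambda>s. (dual_norm \<iota> a (\<iota> (f s)))\<^sup>2)
                      + (max_step tt N)\<^sup>2 * integral {0..T} (\<lambda>s. a (f s) (f s))
                      + (norm u0)\<^sup>2))
       \<and> (\<forall>Y1 Y2 Z1 Z2. Y_space tt N q Y1 \<and> Y_space tt N q Z1
            \<and> (\<forall>X. X_space tt N q X \<longrightarrow> Bstar \<iota> a T Y1 Y2 X = Fform \<iota> T f u0 X)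
            \<and> (\<forall>X. X_space tt N q X \<longrightarrow> Bstar \<iota> a T Z1 Z2 X = Fform \<iota> T f u0 X)
            \<longrightarrow> Y2 = Z2 \<and> (\<forall>i<N. \<forall>s\<in>{tt i<..<tt (Suc i)}. Y1 s = Z1 s))"
proof -
  \<comment> \<open>The condition on \<open>i\<close> stands inside the existential so that one
    family of bases, total in \<open>i\<close>, can be chosen.\<close>
  have "\<forall>i. \<exists>p. i < N \<longrightarrow> orthonormal_polys q (tt i) (tt (Suc i)) p"
    using mesh ex_orthonormal_polys unfolding mesh_ok_def by blast
  then obtain p where p: "\<And>i. i < N \<Longrightarrow> orthonormal_polys q (tt i) (tt (Suc i)) (p i)" by metis
  interpret gelfand_mesh \<iota> a tt N q T p
    by (intro gelfand_mesh.intro gelfand.intro gelfand_mesh_axioms.intro emb_lin emb_inj emb_dense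
        a_bdd a_sym[rule_format] a_coerc mesh p)
  obtain Y1 Y2 where "Y_space tt N q Y1"
    and "\<forall>X. X_space tt N q X \<longrightarrow> Bstar \<iota> a T Y1 Y2 X = Fform \<iota> T f u0 X"
    and "(norm Y2)\<^sup>2 + integral {0..T} (\<lambda>s. a (Y1 s) (Y1 s)) \<le> data_bound f u0"
    using solution_exists[OF f_meas f_L2, of u0] by blast
  moreover have "Y2 = Z2 \<and> (\<forall>i<N. \<forall>s\<in>{tt i<..<tt (Suc i)}. Y1 s = Z1 s)"
    if "Y_space tt N q Y1 \<and> Y_space tt N q Z1
      \<and> (\<forall>X. X_space tt N q X \<longrightarrow> Bstar \<iota> a T Y1 Y2 X = Fform \<iota> T f u0 X)
      \<and> (\<forall>X. X_space tt N q X \<longrightarrow> Bstar \<iota> a T Z1 Z2 X = Fform \<iota> T f u0 X)" for Y1 Y2 Z1 Z2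
    using that by (intro solution_unique) auto
  ultimately show ?thesis
    unfolding data_bound_def[OF f_meas f_L2]
    by (intro conjI exI[of _ Y1] exI[of _ Y2] allI impI real_sqrt_le_mono) blast+
qed

end
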